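(* Let $\mathcal X,\mathcal Y$ be compact metrizable spaces, let $F:\mathcal X\times\mathcal Y\to(0,+\infty)$ be continuous, let $G:[0,+\infty)\to\mathbb R$ be convex and differentiable on $(0,+\infty)$, and let $$c(x,m)=G\left(\int F(x,y)\,m(dy)\right),\qquad x\in\mathcal X,\ m\in\mathcal M(\mathcal Y),$$ be assumed jointly lower semicontinuous. Set $G'(0)=\lim_{u\to0^+}G'(u)\in\mathbb R\cup\{-\infty\}$. If $G'(0)>-\infty$, then for every $\mu\in\mathcal P(\mathcal X)$ and $\nu\in\mathcal P(\mathcal Y)$ there exists a bounded measurable function $\bar f$ on $\mathcal Y$ such that $$\mathcal I_c(\mu,\nu)=\int K_c\bar f(x)\,\mu(dx)-\int\bar f(y)\,\nu(dy).$$ The same conclusion holds if $G'(0)=-\infty$ and $\mathcal Y$ is a finite set. Moreover, if $G$ is non-decreasing (resp. non-increasing) on $[0,+\infty)$, then $\bar f$ can be chosen nonpositive (resp. nonnegative).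
   Context: $\mathcal P(E)$: Borel probability measures on $E$; $\mathcal M(\mathcal Y)$: finite nonnegative Borel measures on $\mathcal Y$ with the weak topology. A nonnegative kernel is a family $q=(q^x)_{x\in\mathcal X}$ in $\mathcal M(\mathcal Y)$ with $x\mapsto q^x(A)$ measurable for all Borel $A\subset\mathcal Y$. $\mathcal Q(\mu,\nu)$ is the set of nonnegative kernels with $\int q^x(dy)\,\mu(dx)=\nu(dy)$, and $\mathcal I_c(\mu,\nu)=\inf_{q\in\mathcal Q(\mu,\nu)}\int c(x,q^x)\,\mu(dx)$. For $f:\mathcal Y\to\mathbb R$ measurable with $\int|f|\,d\nu<\infty$, $$K_cf(x)=\inf\left\{\int f\,dm+c(x,m):\ m\in\mathcal M(\mathcal Y),\ \int|f|\,dm<\infty\right\},\qquad x\in\mathcal X.$$ *)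

theory Defs
  imports "HOL-Probability.Probability"
begin

definition borel_prob_measures :: "'a::topological_space measure set" where
  "borel_prob_measures = {m. sets m = sets borel \<and> prob_space m}"

definition finite_borel_measures :: "'a::topological_space measure set" where
  "finite_borel_measures = {m. sets m = sets borel \<and> finite_measure m}"

text \<open>The weak topology is the coarsest one for which integration of every bounded continuous
  real function is continuous; its carrier is the set of all finite Borel measures.\<close>

definition weak_topology :: "'a::topological_space measure topology" where
  "weak_topology = topology_generated_by
     {{m \<in> finite_borel_measures. (\<integral>y. f y \<partial>m) \<in> U} | (f :: 'a \<Rightarrow> real) U.
        continuous_on UNIV f \<and> bounded (range f) \<and> open U}"

definition lower_semicontinuous_map :: "'a topology \<Rightarrow> ('a \<Rightarrow> ereal) \<Rightarrow> bool" where
  "lower_semicontinuous_map T f \<longleftrightarrow> (\<forall>a. openin T {x \<in> topspace T. a < f x})"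

text \<open>The integral of an extended-real function, positive part minus negative part
  (\<^const>\<open>e2ennreal\<close> maps negative values to \<open>0\<close>). If both parts are infinite, the
  conventions of \<^typ>\<open>ereal\<close> give the value \<open>\<infinity>\<close>.\<close>

definition ext_integral :: "'a measure \<Rightarrow> ('a \<Rightarrow> ereal) \<Rightarrow> ereal" where
  "ext_integral M f =
     enn2ereal (\<integral>\<^sup>+x. e2ennreal (f x) \<partial>M) - enn2ereal (\<integral>\<^sup>+x. e2ennreal (- f x) \<partial>M)"

definition nonneg_kernel :: "('x::topological_space \<Rightarrow> 'y::topological_space measure) \<Rightarrow> bool" where
  "nonneg_kernel q \<longleftrightarrow>
     (\<forall>x. q x \<in> finite_borel_measures) \<and>
     (\<forall>A\<in>sets borel. (\<lambda>x. emeasure (q x) A) \<in> borel_measurable borel)"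

definition transport_kernels ::
    "'x::topological_space measure \<Rightarrow> 'y::topological_space measure \<Rightarrow> ('x \<Rightarrow> 'y measure) set" where
  "transport_kernels \<mu> \<nu> =
     {q. nonneg_kernel q \<and> (\<forall>A\<in>sets borel. (\<integral>\<^sup>+x. emeasure (q x) A \<partial>\<mu>) = emeasure \<nu> A)}"

definition transport_cost ::
    "('x::topological_space \<Rightarrow> 'y::topological_space measure \<Rightarrow> ereal)
      \<Rightarrow> 'x measure \<Rightarrow> 'y measure \<Rightarrow> ereal" where
  "transport_cost c \<mu> \<nu> = (INF q\<in>transport_kernels \<mu> \<nu>. ext_integral \<mu> (\<lambda>x. c x (q x)))"

definition K_transform ::
    "('x \<Rightarrow> 'y::topological_space measure \<Rightarrow> ereal) \<Rightarrow> ('y \<Rightarrow> real) \<Rightarrow> 'x \<Rightarrow> ereal" where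
  "K_transform c f x =
     (INF m\<in>{m \<in> finite_borel_measures. integrable m f}. ereal (\<integral>y. f y \<partial>m) + c x m)"

definition conical_cost ::
    "(real \<Rightarrow> real) \<Rightarrow> ('x \<Rightarrow> 'y \<Rightarrow> real) \<Rightarrow> 'x \<Rightarrow> 'y measure \<Rightarrow> ereal" where
  "conical_cost G F x m = ereal (G (\<integral>y. F x y \<partial>m))"

definition deriv_at_zero :: "(real \<Rightarrow> real) \<Rightarrow> ereal" where
  "deriv_at_zero G = Lim (at_right 0) (\<lambda>u. ereal (deriv G u))"

text \<open>\<open>f\<close> is bounded and measurable, and attains equality in the duality between
  \<^const>\<open>transport_cost\<close> and \<^const>\<open>K_transform\<close>.\<close>

definition dual_optimizer ::
    "('x::topological_space \<Rightarrow> 'y::topological_space measure \<Rightarrow> ereal)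
      \<Rightarrow> 'x measure \<Rightarrow> 'y measure \<Rightarrow> ('y \<Rightarrow> real) \<Rightarrow> bool" where
  "dual_optimizer c \<mu> \<nu> f \<longleftrightarrow>
     f \<in> borel_measurable borel \<and> bounded (range f) \<and>
     transport_cost c \<mu> \<nu> = ext_integral \<mu> (K_transform c f) - ereal (\<integral>y. f y \<partial>\<nu>)"

text \<open>Compact metrizable spaces are rendered as types of class \<^class>\<open>polish_space\<close> whose
  universe is compact. This loses no generality: under any metric inducing its topology, a compact
  metrizable space is complete and second countable, and nothing above depends on the choice of
  the metric.\<close>

end

theory Submission
  imports Defs "HOL-Complex_Analysis.Great_Picard"
begin

text \<open>
  For a conical cost the transform is explicit. A measure \<open>m\<close> enters \<open>\<integral>f dm + G (\<integral>F x dm)\<close> through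
  \<open>u = \<integral>F x dm\<close> and \<open>\<integral>f dm\<close>, and for given \<open>u\<close> the latter is smallest when \<open>m\<close> sits where \<open>f y / F x y\<close>
  is minimal. With \<open>\<phi>\<^sub>f x = (INF y. f y / F x y)\<close>, therefore, \<open>K f x = (INF u\<ge>0. G u + u * \<phi>\<^sub>f x)\<close>, a
  concave non-decreasing function of \<open>\<phi>\<^sub>f x\<close> (\<open>K_transform_conical\<close>), written below as
  \<open>G 0 - excess G (\<phi>\<^sub>f x)\<close>. The inequality \<open>\<integral>K f d\<mu> - \<integral>f d\<nu> \<le> I\<close>, with \<open>I\<close> the optimal cost, is immediate
  (\<open>weak_duality\<close>), so what is needed is a bounded \<open>f\<close> with the reverse inequality.

  Cut the target space into finitely many cells of positive mass and admit only kernels that are,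
  on each cell, a multiple of \<open>\<nu>\<close>. This raises the optimal cost, and leaves a convex problem with finitely
  many linear constraints, the masses of the cells. Lagrange multipliers exist for it by an elementary
  form of the Hahn-Banach theorem (\<open>lagrange_multipliers\<close>, \<open>cell_multipliers\<close>), and a measurable selection
  turns the multiplier inequality into the reverse inequality for the step function whose values are the
  multipliers, with \<open>F\<close> replaced by its averages over cells (\<open>cell_dual_bound\<close>). If the target space is
  finite, the cells can be taken to be points and the proof is complete (\<open>dual_optimizer_finite\<close>).

  Otherwise \<open>F\<close> differs little from its averages on small cells, by compactness, and raising the multipliers
  slightly gives near-optimal pairs \<open>f\<close>, \<open>\<phi>\<close> with \<open>\<phi> x * F x y \<le> f y\<close>. The multipliers are bounded below
  uniformly, because a very negative one would make it profitable to send twice the available mass to its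
  cell (\<open>multipliers_lower_bound\<close>). They can be capped from above when the slope of \<open>G\<close> at \<open>0\<close> is at least
  some real \<open>g\<close>: a price \<open>\<phi>\<close> above \<open>- g\<close> makes any positive mass useless, so raising it further gains
  nothing (\<open>excess_truncate\<close>). Now the \<open>\<phi>\<close> inherit a common modulus of continuity from \<open>F\<close>; a subsequence
  converges pointwise, and Fatou's lemma passes to the limit (\<open>dual_optimizer_compact\<close>).

  The signs come from the same bounds. If \<open>G\<close> is non-decreasing, \<open>g = 0\<close> is a valid slope and the cap on
  \<open>f\<close> is \<open>0\<close>. If \<open>G\<close> is non-increasing, all multipliers are nonnegative (\<open>multipliers_nonneg\<close>).
\<close>

section \<open>Integrals of extended-real functions\<close>

text \<open>The integral of a nonnegative function is a supremum over the simple functions below it, hence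
  monotone on all functions, measurable or not. This is what allows costs \<open>x \<mapsto> c x (q x)\<close> to be bounded below
  without a measurability proof.\<close>

lemma ext_integral_mono:
  assumes "\<And>x. x \<in> space M \<Longrightarrow> f x \<le> g x"
  shows "ext_integral M f \<le> ext_integral M g"
  unfolding ext_integral_def
proof (rule ereal_minus_mono)
  show "enn2ereal (\<integral>\<^sup>+x. e2ennreal (f x) \<partial>M) \<le> enn2ereal (\<integral>\<^sup>+x. e2ennreal (g x) \<partial>M)"
    using assms by (intro less_eq_ennreal.rep_eq[THEN iffD1] nn_integral_mono e2ennreal_mono) auto
  show "enn2ereal (\<integral>\<^sup>+x. e2ennreal (- g x) \<partial>M) \<le> enn2ereal (\<integral>\<^sup>+x. e2ennreal (- f x) \<partial>M)"
    using assms by (intro less_eq_ennreal.rep_eq[THEN iffD1] nn_integral_mono e2ennreal_mono) auto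
qed

text \<open>Additivity in the one shape that occurs below, an integrable function minus a possibly infinite
  nonnegative one. The positive part is then integrable, so no difference of infinities arises.\<close>

lemma ext_integral_diff:
  assumes a: "integrable M a" and W[measurable]: "W \<in> borel_measurable M"
  shows "ext_integral M (\<lambda>x. ereal (a x) - enn2ereal (W x))
    = ereal (\<integral>x. a x \<partial>M) - enn2ereal (\<integral>\<^sup>+x. W x \<partial>M)"
proof -
  have [measurable]: "a \<in> borel_measurable M" using a by auto
  define P where "P = (\<integral>\<^sup>+x. e2ennreal (ereal (a x) - enn2ereal (W x)) \<partial>M)"
  define N where "N = (\<integral>\<^sup>+x. e2ennreal (- (ereal (a x) - enn2ereal (W x))) \<partial>M)"
  define Ap where "Ap = (\<integral>\<^sup>+x. ennreal (a x) \<partial>M)"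
  define An where "An = (\<integral>\<^sup>+x. ennreal (- a x) \<partial>M)"
  define IW where "IW = (\<integral>\<^sup>+x. W x \<partial>M)"
  \<comment> \<open>\<open>s - w\<close> as positive minus negative part, with the subtracted terms moved to the other side\<close>
  have pt: "e2ennreal (ereal s - enn2ereal w) + w + ennreal (- s)
      = e2ennreal (- (ereal s - enn2ereal w)) + ennreal s" for s w
  proof (cases w)
    case (real r)
    have "e2ennreal (ereal s - enn2ereal w) = ennreal (s - r)"
      "e2ennreal (- (ereal s - enn2ereal w)) = ennreal (r - s)"
      using real by (simp_all add: enn2ereal_ennreal e2ennreal_ereal)
    moreover have "ennreal (s - r) + ennreal r + ennreal (- s) = ennreal (r - s) + ennreal s"
      using real by (cases "s \<ge> 0"; cases "s \<ge> r")
        (simp_all add: ennreal_plus[symmetric] ennreal_neg del: ennreal_plus)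
    ultimately show ?thesis using real by simp
  next
    case top
    then show ?thesis by simp
  qed
  have "P + IW + An = (\<integral>\<^sup>+x. e2ennreal (ereal (a x) - enn2ereal (W x)) + W x + ennreal (- a x) \<partial>M)"
    unfolding P_def IW_def An_def by (simp add: nn_integral_add)
  also have "\<dots> = N + Ap"
    unfolding pt N_def Ap_def by (simp add: nn_integral_add)
  finally have eq: "P + IW + An = N + Ap" .
  have fin: "Ap < \<infinity>" "An < \<infinity>"
    using a unfolding Ap_def An_def real_integrable_def by (auto simp: less_top)
  have "P \<le> Ap"
    unfolding P_def Ap_def
  proof (intro nn_integral_mono)
    fix x
    have "ereal (a x) - enn2ereal (W x) \<le> ereal (a x)"
      by (metis ereal_diff_le_self enn2ereal_nonneg)
    then show "e2ennreal (ereal (a x) - enn2ereal (W x)) \<le> ennreal (a x)"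
      by (metis e2ennreal_ereal e2ennreal_mono)
  qed
  then have Pfin: "P < \<infinity>" using fin by (auto simp: less_top top_unique)
  have int: "(\<integral>x. a x \<partial>M) = enn2real Ap - enn2real An"
    using real_lebesgue_integral_def[OF a] by (simp add: Ap_def An_def)
  obtain ap an p where r: "Ap = ennreal ap" "0 \<le> ap" "An = ennreal an" "0 \<le> an" "P = ennreal p" "0 \<le> p"
    using fin Pfin by (metis ennreal_cases infinity_ennreal_def less_irrefl)
  have "enn2ereal P - enn2ereal N = ereal (ap - an) - enn2ereal IW"
  proof (cases IW)
    case (real w)
    then obtain n where n: "N = ennreal n" "0 \<le> n"
      using eq r by (cases N) (auto simp flip: ennreal_plus)
    then have "p + w + an = n + ap"
      using eq r real by (simp flip: ennreal_plus)
    then show ?thesis using r n real by (simp add: enn2ereal_ennreal)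
  next
    case top
    then have "N = top" using eq r by (cases N) (auto simp flip: ennreal_plus)
    then show ?thesis using r top by (simp add: enn2ereal_ennreal)
  qed
  then show ?thesis
    unfolding ext_integral_def P_def[symmetric] N_def[symmetric] IW_def[symmetric] int using r by simp
qed

section \<open>Multipliers, selections, and infima of quotients\<close>

text \<open>Convex duality for finitely many affine constraints, \<open>a i q = 0\<close>, is the one-step extension of the
  Hahn-Banach theorem, repeated. To relax one more constraint, mix a point with \<open>a i p < 0\<close> and
  a point with \<open>a i q > 0\<close> so that the constraint holds: the bound at the mixture says that the slope
  demanded by \<open>q\<close> is at most the slope tolerated by \<open>p\<close>, so one slope serves all points. The existence of points on both sides is
  Slater's condition. Convexity is expressed by the existence of mixtures, so that \<open>Q\<close> can consist of
  functions.\<close>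

lemma lagrange_multipliers:
  fixes \<Phi> :: "'q \<Rightarrow> real" and a :: "'i \<Rightarrow> 'q \<Rightarrow> real"
  assumes fin: "finite J"
    and mix: "\<And>p q s. p \<in> Q \<Longrightarrow> q \<in> Q \<Longrightarrow> 0 \<le> s \<Longrightarrow> s \<le> 1 \<Longrightarrow>
      \<exists>r\<in>Q. \<Phi> r \<le> (1 - s) * \<Phi> p + s * \<Phi> q \<and> (\<forall>i\<in>J. a i r = (1 - s) * a i p + s * a i q)"
    and slater: "\<And>i. i \<in> J \<Longrightarrow>
      \<exists>p\<in>Q. \<exists>q\<in>Q. a i p < 0 \<and> 0 < a i q \<and> (\<forall>j\<in>J - {i}. a j p = 0 \<and> a j q = 0)"
    and bound: "\<And>q. q \<in> Q \<Longrightarrow> (\<forall>i\<in>J. a i q = 0) \<Longrightarrow> t \<le> \<Phi> q"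
  shows "\<exists>l. \<forall>q\<in>Q. t \<le> \<Phi> q + (\<Sum>i\<in>J. l i * a i q)"
proof -
  have "\<exists>l. \<forall>q\<in>Q. (\<forall>i\<in>J - K. a i q = 0) \<longrightarrow> t \<le> \<Phi> q + (\<Sum>i\<in>K. l i * a i q)"
    if "finite K" "K \<subseteq> J" for K
    using that
  proof (induction rule: finite_subset_induct')
    case empty
    then show ?case using bound by auto
  next
    case (insert i K)
    then obtain l where l: "\<And>q. q \<in> Q \<Longrightarrow> (\<forall>j\<in>J - K. a j q = 0) \<Longrightarrow> t \<le> \<Phi> q + (\<Sum>j\<in>K. l j * a j q)"
      by blast
    define \<Psi> where "\<Psi> q = \<Phi> q + (\<Sum>j\<in>K. l j * a j q)" for q
    define Q' where "Q' = {q\<in>Q. \<forall>j\<in>J - insert i K. a j q = 0}"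
    have key: "(t - \<Psi> q) / a i q \<le> (\<Psi> p - t) / (- a i p)"
      if p: "p \<in> Q'" "a i p < 0" and q: "q \<in> Q'" "0 < a i q" for p q
    proof -
      \<comment> \<open>the weight for which the mixture satisfies the constraint\<close>
      define s where "s = - a i p / (a i q - a i p)"
      have s: "0 \<le> s" "s \<le> 1" using p(2) q(2) by (auto simp: s_def divide_simps)
      obtain r where r: "r \<in> Q" "\<Phi> r \<le> (1 - s) * \<Phi> p + s * \<Phi> q"
        "\<And>j. j \<in> J \<Longrightarrow> a j r = (1 - s) * a j p + s * a j q"
        using mix[OF _ _ s] p q unfolding Q'_def by blast
      have D: "a i q - a i p > 0" using p(2) q(2) by simp
      have sD: "s * (a i q - a i p) = - a i p" using D by (simp add: s_def)
      have sD': "(1 - s) * (a i q - a i p) = a i q" using sD by (simp add: algebra_simps)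
      have "a i r = 0"
        using r(3)[OF insert(2)] sD by (simp add: algebra_simps)
      then have "\<forall>j\<in>J - K. a j r = 0"
        using r(3) p(1) q(1) insert(2) unfolding Q'_def
        by (metis (mono_tags, lifting) DiffE DiffI add.right_neutral insertE mem_Collect_eq mult_zero_right)
      then have "t \<le> \<Psi> r" using l[OF r(1)] by (simp add: \<Psi>_def)
      also have "\<dots> \<le> (1 - s) * \<Phi> p + s * \<Phi> q + (\<Sum>j\<in>K. l j * ((1 - s) * a j p + s * a j q))"
        unfolding \<Psi>_def using r(2) r(3) insert(3) by (intro add_mono) (auto intro!: sum_mono simp: subset_iff)
      also have "\<dots> = (1 - s) * \<Psi> p + s * \<Psi> q"
        by (simp add: \<Psi>_def algebra_simps sum.distrib sum_distrib_left sum_subtractf)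
      finally have "t * (a i q - a i p) \<le> ((1 - s) * \<Psi> p + s * \<Psi> q) * (a i q - a i p)"
        using D by (intro mult_right_mono) auto
      also have "\<dots> = ((1 - s) * (a i q - a i p)) * \<Psi> p + (s * (a i q - a i p)) * \<Psi> q"
        by (simp add: algebra_simps)
      also have "\<dots> = a i q * \<Psi> p - a i p * \<Psi> q"
        unfolding sD sD' by simp
      finally have "(t - \<Psi> q) * (- a i p) \<le> (\<Psi> p - t) * a i q" by (simp add: algebra_simps)
      then show ?thesis using p(2) q(2) by (simp add: pos_divide_le_eq pos_le_divide_eq field_simps)
    qed
    obtain p0 q0 where p0: "p0 \<in> Q'" "a i p0 < 0" and q0: "q0 \<in> Q'" "0 < a i q0"
      using slater[OF insert(2)] unfolding Q'_def by blast
    \<comment> \<open>the least slope admissible from the right; by \<open>key\<close> it is admissible from the left\<close>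
    define L where "L = (SUP q\<in>{q\<in>Q'. 0 < a i q}. (t - \<Psi> q) / a i q)"
    have bdd: "bdd_above ((\<lambda>q. (t - \<Psi> q) / a i q) ` {q\<in>Q'. 0 < a i q})"
      using key[OF p0] by (intro bdd_aboveI2[where M="(\<Psi> p0 - t) / (- a i p0)"]) auto
    have "t \<le> \<Psi> q + L * a i q" if q: "q \<in> Q'" for q
    proof -
      consider "a i q > 0" | "a i q = 0" | "a i q < 0" by linarith
      then show ?thesis
      proof cases
        case 1
        then have "(t - \<Psi> q) / a i q \<le> L" unfolding L_def using q bdd by (intro cSUP_upper) auto
        then show ?thesis using 1 by (simp add: field_simps)
      next
        case 2
        then have "\<forall>j\<in>J - K. a j q = 0" using q unfolding Q'_def by auto
        then show ?thesis using l q 2 by (auto simp: \<Psi>_def Q'_def)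
      next
        case 3
        have "L \<le> (\<Psi> q - t) / (- a i q)"
          unfolding L_def using key[OF q 3] q0 by (intro cSUP_least) auto
        then have "L * (- a i q) \<le> \<Psi> q - t" using 3 by (subst (asm) pos_le_divide_eq) auto
        then show ?thesis by linarith
      qed
    qed
    then have "\<forall>q\<in>Q. (\<forall>j\<in>J - insert i K. a j q = 0) \<longrightarrow>
        t \<le> \<Phi> q + (\<Sum>j\<in>insert i K. (l(i := L)) j * a j q)"
    proof (intro ballI impI)
      fix q assume q: "q \<in> Q" "\<forall>j\<in>J - insert i K. a j q = 0"
      have "(\<Sum>j\<in>insert i K. (l(i := L)) j * a j q) = L * a i q + (\<Sum>j\<in>K. l j * a j q)"
        using insert(1,4) by (subst sum.insert) (auto intro!: sum.cong)
      moreover have "t \<le> \<Psi> q + L * a i q"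
        using q by (intro \<open>\<And>q. q \<in> Q' \<Longrightarrow> t \<le> \<Psi> q + L * a i q\<close>) (auto simp: Q'_def)
      ultimately show "t \<le> \<Phi> q + (\<Sum>j\<in>insert i K. (l(i := L)) j * a j q)"
        by (simp add: \<Psi>_def)
    qed
    then show ?case by blast
  qed
  from this[OF fin order_refl] show ?thesis by auto
qed

text \<open>Interchanging an integral with a pointwise minimum amounts to choosing a minimiser measurably.\<close>

lemma measurable_selection_finite:
  fixes h :: "'p \<Rightarrow> 'x \<Rightarrow> real"
  assumes "finite P" "P \<noteq> {}" and "\<And>p. p \<in> P \<Longrightarrow> h p \<in> borel_measurable M"
  shows "\<exists>s\<in>M \<rightarrow>\<^sub>M count_space P. \<forall>x. s x \<in> P \<and> (\<forall>p\<in>P. h (s x) x \<le> h p x)"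
  using assms
proof (induction rule: finite_ne_induct)
  case (singleton p)
  then show ?case by (intro bexI[of _ "\<lambda>_. p"]) auto
next
  case (insert p P)
  have "\<And>q. q \<in> P \<Longrightarrow> h q \<in> borel_measurable M" using insert.prems by blast
  from insert.IH[OF this] obtain s where s: "s \<in> M \<rightarrow>\<^sub>M count_space P" "\<And>x. s x \<in> P"
    "\<And>x q. q \<in> P \<Longrightarrow> h (s x) x \<le> h q x"
    by blast
  have hm[measurable]: "(\<lambda>x. h (s x) x) \<in> borel_measurable M"
    by (rule measurable_compose_countable'[OF _ s(1) countable_finite[OF insert.hyps(1)]])
      (use insert.prems in blast)
  have hp[measurable]: "h p \<in> borel_measurable M" using insert.prems by blast
  have s'[measurable]: "s \<in> M \<rightarrow>\<^sub>M count_space (insert p P)"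
    by (rule measurable_compose[OF s(1), of "\<lambda>x. x"]) (simp add: subset_insertI)
  define s' where "s' x = (if h p x < h (s x) x then p else s x)" for x
  have "s' \<in> M \<rightarrow>\<^sub>M count_space (insert p P)"
    unfolding s'_def
  proof (rule measurable_If)
    show "{x \<in> space M. h p x < h (s x) x} \<in> sets M" by measurable
  qed (use s' in simp_all)
  moreover have "\<forall>x. s' x \<in> insert p P \<and> (\<forall>q\<in>insert p P. h (s' x) x \<le> h q x)"
  proof (intro allI conjI ballI)
    fix x show "s' x \<in> insert p P" using s(2) by (simp add: s'_def)
    fix q assume "q \<in> insert p P"
    then show "h (s' x) x \<le> h q x" using s(3)[of q x] by (auto simp: s'_def)
  qed
  ultimately show ?case by blast
qed

text \<open>The estimate behind all equicontinuity below: the modulus of an infimum of quotients depends on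
  the numerators only through their bound.\<close>

lemma INF_quotient_le:
  fixes c :: "'j \<Rightarrow> real"
  assumes "J \<noteq> {}" "0 < lo" and c: "\<And>j. j \<in> J \<Longrightarrow> \<bar>c j\<bar> \<le> B"
    and k: "\<And>j. j \<in> J \<Longrightarrow> lo \<le> k j" "\<And>j. j \<in> J \<Longrightarrow> lo \<le> k' j"
    and d: "\<And>j. j \<in> J \<Longrightarrow> \<bar>k j - k' j\<bar> \<le> d"
  shows "(INF j\<in>J. c j / k' j) \<le> (INF j\<in>J. c j / k j) + B * d / lo\<^sup>2"
proof -
  have bd: "- (B / lo) \<le> c j / k' j" if "j \<in> J" for j
  proof -
    have "\<bar>c j / k' j\<bar> \<le> B / lo"
      using c[OF that] k[OF that] \<open>0 < lo\<close> by (auto simp: abs_divide intro!: frac_le)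
    then show ?thesis by linarith
  qed
  have "(INF j\<in>J. c j / k' j) - B * d / lo\<^sup>2 \<le> (INF j\<in>J. c j / k j)"
  proof (rule cINF_greatest)
    fix j assume j: "j \<in> J"
    have pos: "k j > 0" "k' j > 0" using k[OF j] \<open>0 < lo\<close> by auto
    have "c j / k' j - c j / k j = c j * (k j - k' j) / (k j * k' j)"
      using pos by (simp add: field_simps)
    also have "\<dots> \<le> \<bar>c j\<bar> * \<bar>k j - k' j\<bar> / (k j * k' j)"
      using pos by (intro divide_right_mono) (auto simp: abs_mult[symmetric])
    also have "\<dots> \<le> B * d / (lo * lo)"
      using c[OF j] k[OF j] d[OF j] \<open>0 < lo\<close> by (intro frac_le mult_mono) (auto intro: mult_nonneg_nonneg)
    finally have "c j / k' j - B * d / lo\<^sup>2 \<le> c j / k j" by (simp add: power2_eq_square)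
    moreover have "(INF j\<in>J. c j / k' j) \<le> c j / k' j"
      using bd j by (intro cINF_lower bdd_belowI2[where m="- (B/lo)"]) auto
    ultimately show "(INF j\<in>J. c j / k' j) - B * d / lo\<^sup>2 \<le> c j / k j" by linarith
  qed (use assms in auto)
  then show ?thesis by linarith
qed

section \<open>The K-transform of a conical cost\<close>

text \<open>In terms of the conjugate \<open>G\<^sup>* p = (SUP u\<ge>0. p u - G u)\<close> this is \<open>G 0 + G\<^sup>* (- s)\<close>. The choice
  \<open>r = 0\<close> makes the supremum nonnegative, so that it can be taken in \<^typ>\<open>ennreal\<close>, where monotone
  convergence and Fatou's lemma need no integrability. Rational arguments suffice when \<open>G\<close> is
  continuous on the positive half-line, and they make the supremum countable.\<close>

definition excess :: "(real \<Rightarrow> real) \<Rightarrow> real \<Rightarrow> ennreal" where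
  "excess G s = (SUP r\<in>{r \<in> \<rat>. 0 \<le> r}. ennreal (G 0 - G r - r * s))"

text \<open>The largest \<open>s\<close> with \<open>s * F x y \<le> f y\<close> for all \<open>y\<close>: the least price, per unit of \<open>\<integral>F x dm\<close>, at which
  \<open>f\<close> sells mass.\<close>

definition slope_bound :: "('x \<Rightarrow> 'y \<Rightarrow> real) \<Rightarrow> ('y \<Rightarrow> real) \<Rightarrow> 'x \<Rightarrow> real" where
  "slope_bound F f x = (INF y. f y / F x y)"

lemma excess_measurable[measurable]: "excess G \<in> borel_measurable borel"
proof -
  have "countable {r::real. r \<in> \<rat> \<and> 0 \<le> r}"
    using countable_subset[OF _ countable_rat, of "{r::real. r \<in> \<rat> \<and> 0 \<le> r}"] by auto
  then show ?thesis unfolding excess_def by measurable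
qed

lemma excess_antimono: "s \<le> t \<Longrightarrow> excess G t \<le> excess G s"
  unfolding excess_def by (intro SUP_subset_mono order_refl ennreal_leI) (auto intro!: mult_left_mono)

locale conical_transport =
  fixes F :: "'x::polish_space \<Rightarrow> 'y::polish_space \<Rightarrow> real" and G :: "real \<Rightarrow> real"
    and \<mu> :: "'x measure" and \<nu> :: "'y measure" and lo hi :: real
  assumes compact_X: "compact (UNIV :: 'x set)" and compact_Y: "compact (UNIV :: 'y set)"
    and F_cont: "continuous_on UNIV (\<lambda>(x, y). F x y)"
    and lo_pos: "0 < lo" and F_lo: "\<And>x y. lo \<le> F x y" and F_hi: "\<And>x y. F x y \<le> hi"
    and G_convex: "convex_on {0..} G"
    and G_diff: "\<And>u. u > 0 \<Longrightarrow> G differentiable (at u)"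
    and \<mu>: "\<mu> \<in> borel_prob_measures" and \<nu>: "\<nu> \<in> borel_prob_measures"
begin

lemma sets_\<mu>[measurable_cong]: "sets \<mu> = sets borel" and prob_\<mu>: "prob_space \<mu>"
  using \<mu> by (auto simp: borel_prob_measures_def)

lemma sets_\<nu>[measurable_cong]: "sets \<nu> = sets borel" and prob_\<nu>: "prob_space \<nu>"
  using \<nu> by (auto simp: borel_prob_measures_def)

lemma space_\<mu>: "space \<mu> = UNIV" using sets_eq_imp_space_eq[OF sets_\<mu>] by simp
lemma space_\<nu>: "space \<nu> = UNIV" using sets_eq_imp_space_eq[OF sets_\<nu>] by simp

lemma F_pos: "0 < F x y" using F_lo[of x y] lo_pos by linarith

lemma hi_pos: "0 < hi" using F_hi F_pos by (meson less_le_trans)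

lemma F_measurable[measurable]: "F x \<in> borel_measurable borel"
proof -
  have "continuous_on UNIV (\<lambda>y. (\<lambda>(x, y). F x y) (x, y))"
    by (rule continuous_on_compose2[OF F_cont]) (auto intro!: continuous_intros)
  then show ?thesis by (intro borel_measurable_continuous_onI) simp
qed

lemma F_uniform:
  assumes "e > 0"
  obtains d where "d > 0"
    "\<And>x x' y y'. dist x x' < d \<Longrightarrow> dist y y' < d \<Longrightarrow> \<bar>F x y - F x' y'\<bar> < e"
proof -
  have "compact (UNIV :: ('x \<times> 'y) set)"
    using compact_Times[OF compact_X compact_Y] by simp
  then have "uniformly_continuous_on UNIV (\<lambda>(x, y). F x y)"
    using F_cont by (intro compact_uniformly_continuous)
  then obtain d where d: "d > 0"
    "\<And>p p'. dist p' p < d \<Longrightarrow> dist ((\<lambda>(x, y). F x y) p') ((\<lambda>(x, y). F x y) p) < e"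
    using assms unfolding uniformly_continuous_on_def by blast
  show thesis
  proof (rule that[of "d / 2"])
    fix x x' y y' assume *: "dist (x::'x) x' < d / 2" "dist (y::'y) y' < d / 2"
    have "dist (x, y) (x', y') \<le> dist x x' + dist y y'"
      by (simp add: dist_Pair_Pair sqrt_sum_squares_le_sum)
    then have "dist (x, y) (x', y') < d" using * by linarith
    from d(2)[OF this] show "\<bar>F x y - F x' y'\<bar> < e" by (simp add: dist_real_def)
  qed (use d in auto)
qed

lemma G_tangent: "\<exists>k. \<forall>u\<ge>0. G 1 + k * (u - 1) \<le> G u"
proof -
  obtain k where k: "(G has_real_derivative k) (at 1)"
    using G_diff[of 1] by (auto simp: real_differentiable_def)
  have "G 1 + k * (u - 1) \<le> G u" if u: "u \<ge> 0" for u
  proof -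
    have "k * (u - 1) \<le> G u - G 1"
      using u by (intro convex_on_imp_above_tangent[OF G_convex _ _ _ has_field_derivative_at_within[OF k]])
        (auto simp: interior_real_atLeast)
    then show ?thesis by simp
  qed
  then show ?thesis by blast
qed

lemma G_upper: "0 \<le> u \<Longrightarrow> u \<le> B \<Longrightarrow> G u \<le> max (G 0) (G B)"
proof (cases "B = 0")
  case False
  assume u: "0 \<le> u" "u \<le> B"
  define t where "t = u / B"
  have t: "0 \<le> t" "t \<le> 1" "u = (1 - t) *\<^sub>R 0 + t *\<^sub>R B" using u False by (auto simp: t_def field_simps)
  have "G u \<le> (1 - t) * G 0 + t * G B"
    unfolding t(3) using u t by (intro convex_onD[OF G_convex]) auto
  also have "\<dots> \<le> (1 - t) * max (G 0) (G B) + t * max (G 0) (G B)"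
    using t by (intro add_mono mult_left_mono) auto
  finally show ?thesis by (simp add: algebra_simps)
qed simp

lemma G_measurable:
  assumes [measurable]: "u \<in> borel_measurable M" and "\<And>x. x \<in> space M \<Longrightarrow> 0 \<le> u x"
  shows "(\<lambda>x. G (u x)) \<in> borel_measurable M"
proof -
  have "continuous_on {0<..} G"
    using G_diff by (intro continuous_at_imp_continuous_on) (auto intro: differentiable_imp_continuous_within)
  then have [measurable]: "(\<lambda>x. indicator {0<..} x *\<^sub>R G x) \<in> borel_measurable borel"
    by (intro borel_measurable_continuous_on_indicator) auto
  have "(\<lambda>x. indicator {0<..} (u x) *\<^sub>R G (u x) + indicator {..0} (u x) * G 0) \<in> borel_measurable M"
    by measurable
  also have "?this \<longleftrightarrow> ?thesis"
    using assms(2) by (intro measurable_cong) (force simp: indicator_def)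
  finally show ?thesis .
qed

text \<open>At \<open>u > 0\<close> the function \<open>G\<close> is continuous and \<open>u\<close> is a limit of rationals; \<open>0\<close> is itself rational.\<close>

lemma excess_upper:
  assumes u: "0 \<le> u"
  shows "ennreal (G 0 - G u - u * s) \<le> excess G s"
proof (cases "u = 0")
  case True
  then show ?thesis by simp
next
  case False
  show ?thesis
  proof (rule ccontr)
    assume "\<not> ?thesis"
    then have less: "excess G s < ennreal (G 0 - G u - u * s)" by simp
    have "isCont G u" using G_diff[of u] False u by (intro differentiable_imp_continuous_within) auto
    then have "((\<lambda>v. ennreal (G 0 - G v - v * s)) \<longlongrightarrow> ennreal (G 0 - G u - u * s)) (at u)"
      by (intro tendsto_intros) (auto simp: isCont_def)
    then have "eventually (\<lambda>v. excess G s < ennreal (G 0 - G v - v * s)) (at u)"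
      using less by (rule order_tendstoD)
    then obtain d where d: "d > 0" "\<And>v. v \<noteq> u \<Longrightarrow> dist v u < d \<Longrightarrow> excess G s < ennreal (G 0 - G v - v * s)"
      unfolding eventually_at by auto
    obtain r where r: "r \<in> \<rat>" "u < r" "r < u + d" using Rats_dense_in_real[of u "u + d"] d by auto
    have "ennreal (G 0 - G r - r * s) \<le> excess G s"
      unfolding excess_def using r u by (intro SUP_upper) auto
    with d(2)[of r] r show False by (auto simp: dist_real_def)
  qed
qed

lemma slope_bound_le:
  assumes "bounded (range f)"
  shows "slope_bound F f x * F x y \<le> f y"
proof -
  obtain B where B: "\<And>y. \<bar>f y\<bar> \<le> B" using assms by (auto simp: bounded_iff)
  have "slope_bound F f x \<le> f y / F x y"
    unfolding slope_bound_def
  proof (intro cINF_lower bdd_belowI2[where m="- (B / lo)"])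
    fix y
    have "\<bar>f y / F x y\<bar> \<le> B / lo"
      using B[of y] F_lo[of x y] lo_pos by (auto simp: abs_divide intro!: frac_le)
    then show "- (B / lo) \<le> f y / F x y" by linarith
  qed auto
  then show ?thesis using F_pos[of x y] by (simp add: field_simps)
qed

lemma slope_bound_greatest:
  assumes "\<And>y. s * F x y \<le> f y"
  shows "s \<le> slope_bound F f x"
  unfolding slope_bound_def using assms F_pos by (intro cINF_greatest) (auto simp: field_simps)

lemma slope_bound_measurable:
  assumes "bounded (range f)"
  shows "slope_bound F f \<in> borel_measurable borel"
proof (rule borel_measurable_continuous_onI)
  obtain B where B: "\<And>y. \<bar>f y\<bar> \<le> B" using assms by (auto simp: bounded_iff)
  have B0: "0 \<le> B" using B[of undefined] by linarith
  show "continuous_on UNIV (slope_bound F f)"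
    unfolding continuous_on_iff
  proof (intro ballI allI impI)
    fix x :: 'x and e :: real assume e: "0 < e"
    define e' where "e' = e * lo\<^sup>2 / (B + 1)"
    have e': "e' > 0" using e lo_pos B0 by (auto simp: e'_def)
    have "B * e' / lo\<^sup>2 = e * (B / (B + 1))" using lo_pos by (simp add: e'_def)
    also have "\<dots> < e * 1" using e B0 by (intro mult_strict_left_mono) auto
    finally have Be: "B * e' / lo\<^sup>2 < e" by simp
    obtain d where d: "d > 0" "\<And>x x' y y'. dist x x' < d \<Longrightarrow> dist y y' < d \<Longrightarrow> \<bar>F x y - F x' y'\<bar> < e'"
      using F_uniform[OF e'] by blast
    have "slope_bound F f x' \<le> slope_bound F f x + B * e' / lo\<^sup>2" if "dist x x' < d" for x x'
      unfolding slope_bound_def using B F_lo lo_pos d(2)[OF that, of y y for y] d(1)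
      by (intro INF_quotient_le) (auto intro: less_imp_le)
    then show "\<exists>d>0. \<forall>x'\<in>UNIV. dist x' x < d \<longrightarrow> dist (slope_bound F f x') (slope_bound F f x) < e"
      using d(1) Be by (intro exI[of _ d]) (force simp: dist_real_def dist_commute abs_less_iff)
  qed
qed

text \<open>Only \<open>u = \<integral>F x dm\<close> and \<open>\<integral>f dm\<close> matter, and \<open>\<integral>f dm \<ge> u * slope_bound F f x\<close>, with near equality for
  multiples of a Dirac mass at a point where \<open>f y / F x y\<close> is almost minimal. What remains is a
  minimisation over \<open>u \<ge> 0\<close>, that is, the conjugate of \<open>G\<close>.\<close>

lemma K_transform_conical:
  assumes [measurable]: "f \<in> borel_measurable borel" and bdd: "bounded (range f)"
  shows "K_transform (conical_cost G F) f x = ereal (G 0) - enn2ereal (excess G (slope_bound F f x))"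
proof (rule antisym)
  let ?K = "K_transform (conical_cost G F) f x" and ?s = "slope_bound F f x"
  obtain B where B: "\<And>y. \<bar>f y\<bar> \<le> B" using bdd by (auto simp: bounded_iff)
  have intf: "integrable m f" and intF: "integrable m (F x)" if "m \<in> finite_borel_measures" for m
  proof -
    interpret finite_measure m using that by (simp add: finite_borel_measures_def)
    have [measurable_cong]: "sets m = sets borel" using that by (simp add: finite_borel_measures_def)
    show "integrable m f" by (rule integrable_const_bound[where B=B]) (use B in auto)
    show "integrable m (F x)"
      by (rule integrable_const_bound[where B=hi]) (use F_hi F_pos in \<open>auto simp: abs_of_pos\<close>)
  qed
  \<comment> \<open>the bound that the measure of mass \<open>t\<close> at \<open>y\<close> gives\<close>
  have dirac: "?K \<le> ereal (t * f y + G (t * F x y))" if t: "0 \<le> t" for t y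
  proof -
    define m where "m = density (return borel y) (\<lambda>_. ennreal t)"
    have m: "m \<in> finite_borel_measures"
      using t by (auto simp: m_def finite_borel_measures_def emeasure_density intro!: finite_measureI)
    have "(\<integral>y. h y \<partial>m) = t * h y" if [measurable]: "h \<in> borel_measurable borel" for h :: "'y \<Rightarrow> real"
      unfolding m_def using t by (subst integral_density) (auto simp: integral_return)
    then have eq: "(\<integral>y. f y \<partial>m) = t * f y" "(\<integral>y. F x y \<partial>m) = t * F x y" by auto
    have "?K \<le> ereal (\<integral>y. f y \<partial>m) + conical_cost G F x m"
      unfolding K_transform_def using m intf by (intro INF_lower) auto
    then show ?thesis by (simp add: conical_cost_def eq)
  qed
  \<comment> \<open>optimise the Dirac mass over \<open>y\<close> at fixed \<open>u\<close>\<close>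
  have lin: "?K \<le> ereal (G u + u * ?s)" if u: "0 \<le> u" for u
  proof (cases "u = 0")
    case True
    then show ?thesis using dirac[of 0] by simp
  next
    case False
    then have u: "0 < u" using u by simp
    show ?thesis
    proof (cases "?K")
      case (real k)
      have "(k - G u) / u \<le> ?s"
      proof (rule slope_bound_greatest)
        fix y
        have "k \<le> u / F x y * f y + G u"
          using dirac[of "u / F x y" y] u F_pos[of x y] real by simp
        then have "(k - G u) \<le> u * (f y / F x y)" by simp
        then have "(k - G u) / u \<le> f y / F x y" using u by (simp add: pos_divide_le_eq mult.commute)
        then show "(k - G u) / u * F x y \<le> f y" using F_pos[of x y] by (simp add: pos_le_divide_eq)
      qed
      then show ?thesis using real u by (simp add: pos_divide_le_eq algebra_simps)
    next
      case PInf
      then show ?thesis using dirac[of 0] by simp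
    qed simp
  qed
  show "?K \<le> ereal (G 0) - enn2ereal (excess G ?s)"
  proof (cases ?K)
    case (real k)
    have "excess G ?s \<le> ennreal (G 0 - k)"
      unfolding excess_def
    proof (rule SUP_least)
      fix r assume "r \<in> {r \<in> \<rat>. 0 \<le> (r::real)}"
      then have "k \<le> G r + r * ?s" using lin[of r] real by simp
      then show "ennreal (G 0 - G r - r * ?s) \<le> ennreal (G 0 - k)" by (intro ennreal_leI) simp
    qed
    moreover have "k \<le> G 0" using lin[of 0] real by simp
    ultimately have "enn2ereal (excess G ?s) \<le> ereal (G 0 - k)"
      by (simp add: less_eq_ennreal.rep_eq enn2ereal_ennreal)
    then show ?thesis unfolding real by (cases "enn2ereal (excess G ?s)") auto
  qed (use lin[of 0] in auto)
  show "ereal (G 0) - enn2ereal (excess G ?s) \<le> ?K"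
    unfolding K_transform_def
  proof (rule INF_greatest)
    fix m assume "m \<in> {m \<in> finite_borel_measures. integrable m f}"
    then have m: "m \<in> finite_borel_measures" by simp
    define u where "u = (\<integral>y. F x y \<partial>m)"
    have "0 \<le> u" unfolding u_def using F_pos by (intro integral_nonneg_AE) (auto intro: less_imp_le)
    then have "ennreal (G 0 - G u - u * ?s) \<le> excess G ?s" by (rule excess_upper)
    then have "ereal (G 0 - G u - u * ?s) \<le> enn2ereal (excess G ?s)"
      by (metis enn2ereal_nonneg ennreal_leI ereal_less_eq(3) less_eq_ennreal.rep_eq enn2ereal_ennreal
          linorder_le_cases order_trans ereal_less_eq(5))
    moreover have "u * ?s \<le> (\<integral>y. f y \<partial>m)"
    proof -
      have "u * ?s = (\<integral>y. ?s * F x y \<partial>m)" by (simp add: u_def)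
      also have "\<dots> \<le> (\<integral>y. f y \<partial>m)"
        using intf[OF m] intF[OF m] slope_bound_le[OF bdd] by (intro integral_mono) auto
      finally show ?thesis .
    qed
    ultimately show "ereal (G 0) - enn2ereal (excess G ?s) \<le> ereal (\<integral>y. f y \<partial>m) + conical_cost G F x m"
      unfolding conical_cost_def u_def[symmetric]
      by (cases "enn2ereal (excess G ?s)") auto
  qed
qed

end

section \<open>Weak duality\<close>

text \<open>The defining identity of a transport kernel, extended from sets to functions.\<close>

lemma transport_kernel_nn_integral:
  fixes h :: "'y::topological_space \<Rightarrow> ennreal"
  assumes q: "q \<in> transport_kernels \<mu> \<nu>"
    and \<mu>: "sets \<mu> = sets borel" and \<nu>: "sets \<nu> = sets borel" and h: "h \<in> borel_measurable borel"
  shows "(\<lambda>x. \<integral>\<^sup>+y. h y \<partial>q x) \<in> borel_measurable borel \<and>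
    (\<integral>\<^sup>+x. (\<integral>\<^sup>+y. h y \<partial>q x) \<partial>\<mu>) = (\<integral>\<^sup>+y. h y \<partial>\<nu>)"
  using h
proof (induction rule: borel_measurable_induct)
  have sq[measurable_cong]: "sets (q x) = sets borel" for x
    using q by (auto simp: transport_kernels_def nonneg_kernel_def finite_borel_measures_def)
  note \<mu>[measurable_cong] \<nu>[measurable_cong]
  {
    case (cong f g)
    have "f = g" using cong(3) by auto
    then show ?case using cong by simp
  next
    case (set A)
    then have [measurable]: "A \<in> sets borel" .
    have "(\<lambda>x. emeasure (q x) A) \<in> borel_measurable borel"
      "(\<integral>\<^sup>+x. emeasure (q x) A \<partial>\<mu>) = emeasure \<nu> A"
      using q set by (auto simp: transport_kernels_def nonneg_kernel_def)
    then show ?case by (simp add: sq \<nu>)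
  next
    case (mult u c)
    note [measurable] = mult(2)
    have [measurable]: "(\<lambda>x. \<integral>\<^sup>+y. u y \<partial>q x) \<in> borel_measurable borel" using mult by simp
    have "(\<integral>\<^sup>+y. c * u y \<partial>q x) = c * (\<integral>\<^sup>+y. u y \<partial>q x)" for x by (rule nn_integral_cmult) measurable
    then show ?case using mult by (simp add: nn_integral_cmult)
  next
    case (add u v)
    note [measurable] = add.hyps(1,3)
    have [measurable]: "(\<lambda>x. \<integral>\<^sup>+y. u y \<partial>q x) \<in> borel_measurable borel"
      "(\<lambda>x. \<integral>\<^sup>+y. v y \<partial>q x) \<in> borel_measurable borel" using add by simp_all
    have "(\<integral>\<^sup>+y. v y + u y \<partial>q x) = (\<integral>\<^sup>+y. v y \<partial>q x) + (\<integral>\<^sup>+y. u y \<partial>q x)" for x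
      by (rule nn_integral_add) measurable
    then show ?case using add by (simp add: nn_integral_add)
  next
    case (seq U)
    note [measurable] = seq.hyps(1)
    have [measurable]: "\<And>i. (\<lambda>x. \<integral>\<^sup>+y. U i y \<partial>q x) \<in> borel_measurable borel" using seq by simp
    have 1: "(\<integral>\<^sup>+y. (SUP i. U i) y \<partial>q x) = (SUP i. \<integral>\<^sup>+y. U i y \<partial>q x)" for x
      unfolding SUP_apply by (rule nn_integral_monotone_convergence_SUP[OF seq.hyps(3)]) measurable
    have 2: "(\<integral>\<^sup>+y. (SUP i. U i) y \<partial>\<nu>) = (SUP i. \<integral>\<^sup>+y. U i y \<partial>\<nu>)"
      unfolding SUP_apply by (rule nn_integral_monotone_convergence_SUP[OF seq.hyps(3)]) measurable
    have "incseq (\<lambda>i x. \<integral>\<^sup>+y. U i y \<partial>q x)"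
      using seq.hyps(3) by (auto simp: incseq_def le_fun_def intro!: nn_integral_mono)
    then have 3: "(\<integral>\<^sup>+x. (SUP i. \<integral>\<^sup>+y. U i y \<partial>q x) \<partial>\<mu>) = (SUP i. \<integral>\<^sup>+x. (\<integral>\<^sup>+y. U i y \<partial>q x) \<partial>\<mu>)"
      by (rule nn_integral_monotone_convergence_SUP) measurable
    show ?case unfolding 1 2 3 using seq by (simp del: SUP_apply)
  }
qed

lemma transport_kernel_integral:
  fixes f :: "'y::topological_space \<Rightarrow> real"
  assumes q: "q \<in> transport_kernels \<mu> \<nu>"
    and \<mu>[measurable_cong]: "sets \<mu> = sets borel" and \<nu>[measurable_cong]: "sets \<nu> = sets borel" and fin: "finite_measure \<nu>"
    and f[measurable]: "f \<in> borel_measurable borel" and B: "\<And>y. \<bar>f y\<bar> \<le> B"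
  shows "\<And>x. integrable (q x) f" and "integrable \<mu> (\<lambda>x. \<integral>y. f y \<partial>q x)"
    and "(\<integral>x. (\<integral>y. f y \<partial>q x) \<partial>\<mu>) = (\<integral>y. f y \<partial>\<nu>)"
proof -
  have sq[measurable_cong]: "sets (q x) = sets borel" and fq: "finite_measure (q x)" for x
    using q by (auto simp: transport_kernels_def nonneg_kernel_def finite_borel_measures_def)
  interpret \<nu>: finite_measure \<nu> by fact
  have intf: "integrable (q x) f" for x
    by (rule finite_measure.integrable_const_bound[OF fq, where B=B]) (use B in auto)
  show "integrable (q x) f" for x by (rule intf)
  have int\<nu>: "integrable \<nu> f"
    by (rule \<nu>.integrable_const_bound[where B=B]) (use B in auto)
  define p where "p g x = enn2real (\<integral>\<^sup>+y. ennreal (g y) \<partial>q x)" for g :: "'y \<Rightarrow> real" and x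
  have p: "integrable \<mu> (p g) \<and> (\<integral>x. p g x \<partial>\<mu>) = enn2real (\<integral>\<^sup>+y. ennreal (g y) \<partial>\<nu>)"
    if [measurable]: "g \<in> borel_measurable borel" and g: "\<And>y. \<bar>g y\<bar> \<le> B" for g
  proof -
    have tk: "(\<lambda>x. \<integral>\<^sup>+y. ennreal (g y) \<partial>q x) \<in> borel_measurable borel"
      "(\<integral>\<^sup>+x. (\<integral>\<^sup>+y. ennreal (g y) \<partial>q x) \<partial>\<mu>) = (\<integral>\<^sup>+y. ennreal (g y) \<partial>\<nu>)"
      using transport_kernel_nn_integral[OF q \<mu> \<nu>, of "\<lambda>y. ennreal (g y)"] by auto
    have nn: "0 \<le> p g x" for x by (simp add: p_def)
    have [measurable]: "p g \<in> borel_measurable \<mu>"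
    proof (subst measurable_cong_sets[OF \<mu> refl])
      show "p g \<in> borel_measurable borel"
        unfolding p_def[abs_def] by (rule borel_measurable_enn2real[OF tk(1)])
    qed
    have "integrable (q x) g" for x
      by (rule finite_measure.integrable_const_bound[OF fq, where B=B]) (use g in auto)
    then have "(\<integral>\<^sup>+y. ennreal (g y) \<partial>q x) \<noteq> \<infinity>" for x
      unfolding real_integrable_def by auto
    then have eq: "ennreal (p g x) = (\<integral>\<^sup>+y. ennreal (g y) \<partial>q x)" for x
      unfolding p_def by (simp add: less_top)
    have "integrable \<nu> g"
      by (rule \<nu>.integrable_const_bound[where B=B]) (use g in auto)
    then have "(\<integral>\<^sup>+y. ennreal (g y) \<partial>\<nu>) \<noteq> \<infinity>" unfolding real_integrable_def by auto
    then have "(\<integral>\<^sup>+x. ennreal (p g x) \<partial>\<mu>) < \<infinity>" unfolding eq tk(2) by (simp add: less_top)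
    then have "integrable \<mu> (p g)"
      by (intro integrableI_nonneg) (auto simp: nn)
    moreover have "(\<integral>x. p g x \<partial>\<mu>) = enn2real (\<integral>\<^sup>+x. ennreal (p g x) \<partial>\<mu>)"
      by (rule integral_eq_nn_integral) (auto simp: nn)
    ultimately show ?thesis unfolding eq tk(2) by simp
  qed
  have eq: "(\<integral>y. f y \<partial>q x) = p f x - p (\<lambda>y. - f y) x" for x
    unfolding p_def by (rule real_lebesgue_integral_def[OF intf])
  note pf = p[OF f B] and pn = p[of "\<lambda>y. - f y"]
  show "integrable \<mu> (\<lambda>x. \<integral>y. f y \<partial>q x)"
    unfolding eq using pf pn B by (intro Bochner_Integration.integrable_diff) auto
  show "(\<integral>x. (\<integral>y. f y \<partial>q x) \<partial>\<mu>) = (\<integral>y. f y \<partial>\<nu>)"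
    unfolding eq real_lebesgue_integral_def[OF int\<nu>] using pf pn B by simp
qed

context conical_transport
begin

lemma ext_integral_K_transform:
  assumes f: "f \<in> borel_measurable borel" and bdd: "bounded (range f)"
  shows "ext_integral \<mu> (K_transform (conical_cost G F) f)
    = ereal (G 0) - enn2ereal (\<integral>\<^sup>+x. excess G (slope_bound F f x) \<partial>\<mu>)"
proof -
  interpret prob_space \<mu> by (rule prob_\<mu>)
  have [measurable]: "slope_bound F f \<in> borel_measurable \<mu>"
    unfolding measurable_cong_sets[OF sets_\<mu> refl] by (rule slope_bound_measurable[OF bdd])
  show ?thesis
    unfolding K_transform_conical[OF assms, abs_def]
    by (subst ext_integral_diff) (auto simp: prob_space)
qed

text \<open>By definition of the transform, \<open>K f x - \<integral>f dq\<^sup>x \<le> c x q\<^sup>x\<close>. The left-hand side is measurable, so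
  its integral can be computed, and monotonicity of \<^const>\<open>ext_integral\<close> does the rest.\<close>

lemma weak_duality:
  assumes f: "f \<in> borel_measurable borel" and bdd: "bounded (range f)"
  shows "ext_integral \<mu> (K_transform (conical_cost G F) f) - ereal (\<integral>y. f y \<partial>\<nu>)
    \<le> transport_cost (conical_cost G F) \<mu> \<nu>"
  unfolding transport_cost_def
proof (rule INF_greatest)
  fix q assume q: "q \<in> transport_kernels \<mu> \<nu>"
  interpret \<mu>: prob_space \<mu> by (rule prob_\<mu>)
  obtain B where B: "\<And>y. \<bar>f y\<bar> \<le> B" using bdd by (auto simp: bounded_iff)
  note k = transport_kernel_integral[OF q sets_\<mu> sets_\<nu> prob_space.finite_measure[OF prob_\<nu>] f B]
  define W where "W x = excess G (slope_bound F f x)" for x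
  have [measurable]: "slope_bound F f \<in> borel_measurable \<mu>"
    unfolding measurable_cong_sets[OF sets_\<mu> refl] by (rule slope_bound_measurable[OF bdd])
  have [measurable]: "W \<in> borel_measurable \<mu>" unfolding W_def by measurable
  define g where "g x = (\<integral>y. f y \<partial>q x)" for x
  have g: "integrable \<mu> g" "(\<integral>x. g x \<partial>\<mu>) = (\<integral>y. f y \<partial>\<nu>)" using k(2,3) by (simp_all add: g_def[abs_def])
  have le: "ereal (G 0 - g x) - enn2ereal (W x) \<le> conical_cost G F x (q x)" for x
  proof -
    have "q x \<in> finite_borel_measures" using q by (auto simp: transport_kernels_def nonneg_kernel_def)
    then have "K_transform (conical_cost G F) f x \<le> ereal (g x) + conical_cost G F x (q x)"
      unfolding K_transform_def g_def using k(1) by (intro INF_lower) auto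
    then show ?thesis
      unfolding K_transform_conical[OF assms] W_def[symmetric] conical_cost_def
      by (cases "enn2ereal (W x)") auto
  qed
  have "ext_integral \<mu> (\<lambda>x. ereal (G 0 - g x) - enn2ereal (W x)) =
      ereal (\<integral>x. G 0 - g x \<partial>\<mu>) - enn2ereal (\<integral>\<^sup>+x. W x \<partial>\<mu>)"
    using g by (intro ext_integral_diff) auto
  also have "(\<integral>x. G 0 - g x \<partial>\<mu>) = G 0 - (\<integral>y. f y \<partial>\<nu>)"
    using g by (simp add: \<mu>.prob_space)
  finally have "ext_integral \<mu> (\<lambda>x. ereal (G 0 - g x) - enn2ereal (W x))
    = ext_integral \<mu> (K_transform (conical_cost G F) f) - ereal (\<integral>y. f y \<partial>\<nu>)"
    unfolding ext_integral_K_transform[OF assms] W_def[symmetric]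
    by (cases "enn2ereal (\<integral>\<^sup>+x. W x \<partial>\<mu>)") auto
  then show "ext_integral \<mu> (K_transform (conical_cost G F) f) - ereal (\<integral>y. f y \<partial>\<nu>)
      \<le> ext_integral \<mu> (\<lambda>x. conical_cost G F x (q x))"
    using ext_integral_mono[of \<mu> "\<lambda>x. ereal (G 0 - g x) - enn2ereal (W x)", OF le] by simp
qed

text \<open>The constant kernel \<open>\<nu>\<close> bounds the cost above. For a lower bound, a tangent of \<open>G\<close> bounds the
  conjugate, and weak duality is applied to a large constant \<open>f\<close>.\<close>

lemma transport_cost_finite: "\<exists>I. transport_cost (conical_cost G F) \<mu> \<nu> = ereal I"
proof -
  interpret \<mu>: prob_space \<mu> by (rule prob_\<mu>)
  interpret \<nu>: prob_space \<nu> by (rule prob_\<nu>)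
  define m where "m = max (G 0) (G hi)"
  have "(\<lambda>_. \<nu>) \<in> transport_kernels \<mu> \<nu>"
    using \<nu> \<mu>.emeasure_space_1
    by (auto simp: transport_kernels_def nonneg_kernel_def finite_borel_measures_def borel_prob_measures_def
        prob_space.finite_measure)
  then have "transport_cost (conical_cost G F) \<mu> \<nu> \<le> ext_integral \<mu> (\<lambda>x. conical_cost G F x \<nu>)"
    unfolding transport_cost_def by (rule INF_lower)
  also have "\<dots> \<le> ext_integral \<mu> (\<lambda>x. ereal m - enn2ereal 0)"
  proof (rule ext_integral_mono)
    fix x
    have "integrable \<nu> (F x)"
      by (rule \<nu>.integrable_const_bound[where B=hi]) (use F_hi F_pos in \<open>auto simp: abs_of_pos\<close>)
    then have "(\<integral>y. F x y \<partial>\<nu>) \<le> (\<integral>y. hi \<partial>\<nu>)" using F_hi by (intro integral_mono) auto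
    moreover have "0 \<le> (\<integral>y. F x y \<partial>\<nu>)" using F_pos by (intro integral_nonneg_AE) (auto intro: less_imp_le)
    ultimately show "conical_cost G F x \<nu> \<le> ereal m - enn2ereal 0"
      unfolding conical_cost_def m_def using G_upper[of "\<integral>y. F x y \<partial>\<nu>" hi]
      by (simp add: \<nu>.prob_space zero_ennreal.rep_eq flip: ereal_max)
  qed
  also have "\<dots> = ereal m" by (subst ext_integral_diff) (auto simp: \<mu>.prob_space zero_ennreal.rep_eq)
  finally have up: "transport_cost (conical_cost G F) \<mu> \<nu> \<le> ereal m" .
  obtain k where k: "\<And>u. u \<ge> 0 \<Longrightarrow> G 1 + k * (u - 1) \<le> G u" using G_tangent by blast
  \<comment> \<open>large enough for the slope bound to dominate the slope \<open>- k\<close> of the tangent\<close>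
  define f where "f = (\<lambda>y::'y. \<bar>k\<bar> * hi)"
  have f: "f \<in> borel_measurable borel" "bounded (range f)" by (auto simp: f_def)
  have "(\<integral>\<^sup>+x. excess G (slope_bound F f x) \<partial>\<mu>) \<le> (\<integral>\<^sup>+x. ennreal (G 0 - G 1 + k) \<partial>\<mu>)"
  proof (rule nn_integral_mono)
    fix x
    have "\<bar>k\<bar> \<le> slope_bound F f x"
      using F_hi by (intro slope_bound_greatest) (auto simp: f_def intro: mult_left_mono)
    then have "excess G (slope_bound F f x) \<le> excess G \<bar>k\<bar>" by (rule excess_antimono)
    also have "\<dots> \<le> ennreal (G 0 - G 1 + k)"
      unfolding excess_def
    proof (rule SUP_least)
      fix r assume "r \<in> {r \<in> \<rat>. 0 \<le> (r::real)}"
      then have r: "0 \<le> r" by simp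
      have "- k * r \<le> \<bar>k\<bar> * r" using r by (intro mult_right_mono) auto
      then show "ennreal (G 0 - G r - r * \<bar>k\<bar>) \<le> ennreal (G 0 - G 1 + k)"
        using k[OF r] by (intro ennreal_leI) (simp add: algebra_simps)
    qed
    finally show "excess G (slope_bound F f x) \<le> ennreal (G 0 - G 1 + k)" .
  qed
  then have "(\<integral>\<^sup>+x. excess G (slope_bound F f x) \<partial>\<mu>) < top"
    by (simp add: \<mu>.emeasure_space_1 le_less_trans)
  then have "ext_integral \<mu> (K_transform (conical_cost G F) f) - ereal (\<integral>y. f y \<partial>\<nu>) \<noteq> -\<infinity>"
    unfolding ext_integral_K_transform[OF f]
    by (cases "\<integral>\<^sup>+x. excess G (slope_bound F f x) \<partial>\<mu>") (auto simp: enn2ereal_ennreal)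
  with weak_duality[OF f] up show ?thesis
    by (cases "transport_cost (conical_cost G F) \<mu> \<nu>") auto
qed

text \<open>By weak duality, the reverse inequality alone has to be checked, and it may be checked with any
  \<open>\<phi>\<close> below the slope bound of \<open>f\<close>, as \<^const>\<open>excess\<close> is antitone.\<close>

lemma dual_optimizerI:
  assumes f: "f \<in> borel_measurable borel" and bdd: "bounded (range f)"
    and \<phi>: "\<And>x y. \<phi> x * F x y \<le> f y"
    and le: "enn2ereal (\<integral>\<^sup>+x. excess G (\<phi> x) \<partial>\<mu>) \<le> ereal (G 0 - I - (\<integral>y. f y \<partial>\<nu>))"
    and I: "transport_cost (conical_cost G F) \<mu> \<nu> = ereal I"
  shows "dual_optimizer (conical_cost G F) \<mu> \<nu> f"
proof -
  have "(\<integral>\<^sup>+x. excess G (slope_bound F f x) \<partial>\<mu>) \<le> (\<integral>\<^sup>+x. excess G (\<phi> x) \<partial>\<mu>)"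
    using \<phi> by (intro nn_integral_mono excess_antimono slope_bound_greatest)
  with le have le': "enn2ereal (\<integral>\<^sup>+x. excess G (slope_bound F f x) \<partial>\<mu>) \<le> ereal (G 0 - I - (\<integral>y. f y \<partial>\<nu>))"
    by (meson less_eq_ennreal.rep_eq order_trans)
  have "ereal I \<le> ext_integral \<mu> (K_transform (conical_cost G F) f) - ereal (\<integral>y. f y \<partial>\<nu>)"
    unfolding ext_integral_K_transform[OF f bdd]
    using le' by (cases "enn2ereal (\<integral>\<^sup>+x. excess G (slope_bound F f x) \<partial>\<mu>)") auto
  with weak_duality[OF f bdd] f bdd show ?thesis
    unfolding dual_optimizer_def I by auto
qed

end

context conical_transport
begin

text \<open>A convex function lies between a tangent and the larger of its two end values, so \<open>G\<close> is bounded
  on bounded intervals.\<close>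

lemma G_integrable:
  assumes [measurable]: "u \<in> borel_measurable \<mu>" and u: "\<And>x. 0 \<le> u x" "\<And>x. u x \<le> U"
  shows "integrable \<mu> (\<lambda>x. G (u x))"
proof -
  interpret \<mu>: prob_space \<mu> by (rule prob_\<mu>)
  have [measurable]: "(\<lambda>x. G (u x)) \<in> borel_measurable \<mu>"
    using u by (intro G_measurable) auto
  obtain k where k: "\<And>v. v \<ge> 0 \<Longrightarrow> G 1 + k * (v - 1) \<le> G v" using G_tangent by blast
  have "\<bar>G (u x)\<bar> \<le> \<bar>G 0\<bar> + \<bar>G U\<bar> + \<bar>G 1\<bar> + \<bar>k\<bar> * (U + 1)" for x
  proof -
    have "\<bar>k * (u x - 1)\<bar> \<le> \<bar>k\<bar> * (U + 1)"
      using u[of x] unfolding abs_mult by (intro mult_left_mono) auto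
    then show ?thesis using k[OF u(1), of x] G_upper[OF u, of x] by linarith
  qed
  then show ?thesis by (intro \<mu>.integrable_const_bound[where B="\<bar>G 0\<bar> + \<bar>G U\<bar> + \<bar>G 1\<bar> + \<bar>k\<bar> * (U + 1)"]) auto
qed

end

section \<open>Kernels with a step density\<close>

text \<open>Cells of positive mass that cover the target space up to a \<open>\<nu>\<close>-null set. Positivity of the masses makes
  \<open>i \<mapsto> \<nu> (A i)\<close> an interior point of the positive orthant, which is Slater's condition.\<close>

locale cell_partition = conical_transport F G \<mu> \<nu> lo hi
  for F :: "'x::polish_space \<Rightarrow> 'y::polish_space \<Rightarrow> real" and G \<mu> \<nu> lo hi +
  fixes J :: "'i set" and A :: "'i \<Rightarrow> 'y set"
  assumes fin_J: "finite J"
    and A_sets: "\<And>i. i \<in> J \<Longrightarrow> A i \<in> sets borel"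
    and disj: "disjoint_family_on A J"
    and A_pos: "\<And>i. i \<in> J \<Longrightarrow> 0 < measure \<nu> (A i)"
    and A_full: "measure \<nu> (\<Union>i\<in>J. A i) = 1"
begin

sublocale \<mu>: prob_space \<mu> by (rule prob_\<mu>)
sublocale \<nu>: prob_space \<nu> by (rule prob_\<nu>)

definition w :: "'i \<Rightarrow> real" where "w i = measure \<nu> (A i)"

text \<open>The average of \<open>F x\<close> over a cell. With averages, rather than values at chosen points, the discretised
  problem is exactly the transport problem restricted to the kernels \<open>cell_kernel q\<close> below, so it costs
  no error in the primal value, however fast \<open>G\<close> grows.\<close>

definition cell_mean :: "'i \<Rightarrow> 'x \<Rightarrow> real" where
  "cell_mean i x = (\<integral>y. indicator (A i) y * F x y \<partial>\<nu>) / w i"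

lemma w_pos: "i \<in> J \<Longrightarrow> 0 < w i" using A_pos by (simp add: w_def)

lemma sum_w: "(\<Sum>i\<in>J. w i) = 1"
  unfolding w_def A_full[symmetric]
  using A_sets by (intro \<nu>.finite_measure_finite_Union[OF fin_J _ disj, symmetric]) (auto simp: sets_\<nu>)

lemma J_nonempty: "J \<noteq> {}" using sum_w by auto

lemma integrable_cell: "i \<in> J \<Longrightarrow> integrable \<nu> (\<lambda>y. indicator (A i) y * F x y)"
proof -
  assume "i \<in> J"
  then have [measurable]: "A i \<in> sets borel" by (rule A_sets)
  show ?thesis
    by (rule \<nu>.integrable_const_bound[where B=hi])
      (use F_hi hi_pos F_pos in \<open>auto simp: indicator_def abs_of_pos less_imp_le\<close>)
qed

lemma integral_cell_const: "i \<in> J \<Longrightarrow> (\<integral>y. indicator (A i) y * c \<partial>\<nu>) = w i * c"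
  using A_sets by (simp add: w_def sets_\<nu> space_\<nu>)

lemma integrable_cell_const: "i \<in> J \<Longrightarrow> integrable \<nu> (\<lambda>y. indicator (A i) y * (c::real))"
  using A_sets by (intro integrable_mult_left integrable_real_indicator) (auto simp: sets_\<nu> less_top[symmetric])

lemma cell_mean_ge:
  assumes i: "i \<in> J" and "\<And>y. y \<in> A i \<Longrightarrow> c \<le> F x y"
  shows "c \<le> cell_mean i x"
proof -
  have "w i * c \<le> (\<integral>y. indicator (A i) y * F x y \<partial>\<nu>)"
    unfolding integral_cell_const[OF i, symmetric]
    using integrable_cell[OF i] integrable_cell_const[OF i] assms(2)
    by (intro integral_mono) (auto simp: indicator_def)
  then show ?thesis using w_pos[OF i] by (simp add: cell_mean_def field_simps)
qed

lemma cell_mean_le: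
  assumes i: "i \<in> J" and "\<And>y. y \<in> A i \<Longrightarrow> F x y \<le> c"
  shows "cell_mean i x \<le> c"
proof -
  have "(\<integral>y. indicator (A i) y * F x y \<partial>\<nu>) \<le> w i * c"
    unfolding integral_cell_const[OF i, symmetric]
    using integrable_cell[OF i] integrable_cell_const[OF i] assms(2)
    by (intro integral_mono) (auto simp: indicator_def)
  then show ?thesis using w_pos[OF i] by (simp add: cell_mean_def field_simps)
qed

lemma cell_mean_lo: "i \<in> J \<Longrightarrow> lo \<le> cell_mean i x" and cell_mean_hi: "i \<in> J \<Longrightarrow> cell_mean i x \<le> hi"
  using F_lo F_hi by (auto intro: cell_mean_ge cell_mean_le)

lemma cell_mean_pos: "i \<in> J \<Longrightarrow> 0 < cell_mean i x"
  using cell_mean_lo lo_pos by (meson less_le_trans)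

lemma cell_mean_diff:
  assumes i: "i \<in> J" and d: "\<And>y. \<bar>F x y - F x' y\<bar> \<le> d"
  shows "\<bar>cell_mean i x - cell_mean i x'\<bar> \<le> d"
proof -
  have "cell_mean i x \<le> cell_mean i x' + d" if d: "\<And>y. \<bar>F x y - F x' y\<bar> \<le> d" for x x'
  proof -
    have "(\<integral>y. indicator (A i) y * F x y \<partial>\<nu>) \<le> (\<integral>y. indicator (A i) y * F x' y + indicator (A i) y * d \<partial>\<nu>)"
      using integrable_cell[OF i] integrable_cell_const[OF i]
    proof (intro integral_mono integrable_add)
      fix y show "indicator (A i) y * F x y \<le> indicator (A i) y * F x' y + indicator (A i) y * d"
        using d[of y] by (auto simp: indicator_def)
    qed auto
    also have "\<dots> = (\<integral>y. indicator (A i) y * F x' y \<partial>\<nu>) + w i * d"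
      using integrable_cell[OF i] integrable_cell_const[OF i] integral_cell_const[OF i] by simp
    finally show ?thesis using w_pos[OF i] by (simp add: cell_mean_def field_simps)
  qed
  from this[of x x'] this[of x' x] d show ?thesis by (auto simp: abs_minus_commute abs_le_iff)
qed

lemma cell_mean_measurable:
  assumes i: "i \<in> J"
  shows "cell_mean i \<in> borel_measurable borel"
proof (rule borel_measurable_continuous_onI)
  show "continuous_on UNIV (cell_mean i)"
    unfolding continuous_on_iff
  proof (intro ballI allI impI)
    fix x :: 'x and e :: real assume e: "0 < e"
    obtain d where d: "d > 0" "\<And>x x' y y'. dist x x' < d \<Longrightarrow> dist y y' < d \<Longrightarrow> \<bar>F x y - F x' y'\<bar> < e / 2"
      using F_uniform[of "e/2"] e by auto
    have "dist (cell_mean i x') (cell_mean i x) < e" if "dist x' x < d" for x'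
    proof -
      have "\<bar>cell_mean i x' - cell_mean i x\<bar> \<le> e / 2"
        using d(2)[OF that, of y y for y] d(1) by (intro cell_mean_diff[OF i]) (auto intro: less_imp_le)
      then show ?thesis using e by (simp add: dist_real_def)
    qed
    then show "\<exists>d>0. \<forall>x'\<in>UNIV. dist x' x < d \<longrightarrow> dist (cell_mean i x') (cell_mean i x) < e"
      using d(1) by blast
  qed
qed

text \<open>\<open>q i x\<close> is the mass that \<open>x\<close> sends to the cell \<open>A i\<close>.\<close>

definition cell_controls :: "('i \<Rightarrow> 'x \<Rightarrow> real) set" where
  "cell_controls = {q. \<forall>i\<in>J. q i \<in> borel_measurable borel \<and> (\<forall>x. 0 \<le> q i x) \<and> (\<exists>B. \<forall>x. q i x \<le> B)}"

lemma cell_controls_nonneg: "q \<in> cell_controls \<Longrightarrow> i \<in> J \<Longrightarrow> 0 \<le> q i x"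
  and cell_controls_measurable: "q \<in> cell_controls \<Longrightarrow> i \<in> J \<Longrightarrow> q i \<in> borel_measurable borel"
  by (auto simp: cell_controls_def)

lemma cell_controls_bound: "q \<in> cell_controls \<Longrightarrow> \<exists>B. \<forall>i\<in>J. \<forall>x. q i x \<le> B i"
  unfolding cell_controls_def by (intro bchoice) blast

definition cell_cost :: "('i \<Rightarrow> 'x \<Rightarrow> real) \<Rightarrow> real" where
  "cell_cost q = (\<integral>x. G (\<Sum>i\<in>J. q i x * cell_mean i x) \<partial>\<mu>)"

lemma cell_controls_integrable:
  assumes q: "q \<in> cell_controls" and i: "i \<in> J"
  shows "integrable \<mu> (q i)"
proof -
  obtain B where B: "\<And>x. q i x \<le> B i" using cell_controls_bound[OF q] i by blast
  have [measurable]: "q i \<in> borel_measurable borel" using assms by (rule cell_controls_measurable)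
  show ?thesis
    by (rule \<mu>.integrable_const_bound[where B="B i"]) (use B cell_controls_nonneg[OF assms] in auto)
qed

lemma cell_flux:
  assumes q: "q \<in> cell_controls"
  shows "(\<lambda>x. \<Sum>i\<in>J. q i x * cell_mean i x) \<in> borel_measurable borel"
    and "0 \<le> (\<Sum>i\<in>J. q i x * cell_mean i x)"
    and "\<exists>U. \<forall>x. (\<Sum>i\<in>J. q i x * cell_mean i x) \<le> U"
proof -
  have [measurable]: "\<And>i. i \<in> J \<Longrightarrow> q i \<in> borel_measurable borel" "\<And>i. i \<in> J \<Longrightarrow> cell_mean i \<in> borel_measurable borel"
    using cell_controls_measurable[OF q] cell_mean_measurable by blast+
  show "(\<lambda>x. \<Sum>i\<in>J. q i x * cell_mean i x) \<in> borel_measurable borel"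
    by measurable
  show "0 \<le> (\<Sum>i\<in>J. q i x * cell_mean i x)"
    by (intro sum_nonneg mult_nonneg_nonneg cell_controls_nonneg[OF q] less_imp_le[OF cell_mean_pos])
  obtain B where B: "\<And>i x. i \<in> J \<Longrightarrow> q i x \<le> B i" using cell_controls_bound[OF q] by blast
  have "(\<Sum>i\<in>J. q i x * cell_mean i x) \<le> (\<Sum>i\<in>J. B i * hi)" for x
  proof (intro sum_mono mult_mono)
    fix i assume i: "i \<in> J"
    show "q i x \<le> B i" "cell_mean i x \<le> hi" "0 \<le> cell_mean i x" "0 \<le> B i"
      using B[OF i, of x] cell_mean_hi[OF i] cell_mean_pos[OF i, of x] cell_controls_nonneg[OF q i, of x] by auto
  qed
  then show "\<exists>U. \<forall>x. (\<Sum>i\<in>J. q i x * cell_mean i x) \<le> U" by blast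
qed

lemma cell_cost_integrable:
  assumes q: "q \<in> cell_controls"
  shows "integrable \<mu> (\<lambda>x. G (\<Sum>i\<in>J. q i x * cell_mean i x))"
proof -
  obtain U where "\<And>x. (\<Sum>i\<in>J. q i x * cell_mean i x) \<le> U" using cell_flux(3)[OF q] by blast
  then show ?thesis
    using cell_flux(1,2)[OF q] by (intro G_integrable) (auto simp: measurable_cong_sets[OF sets_\<mu> refl])
qed

definition cell_kernel :: "('i \<Rightarrow> 'x \<Rightarrow> real) \<Rightarrow> 'x \<Rightarrow> 'y measure" where
  "cell_kernel q x = density \<nu> (\<lambda>y. ennreal (\<Sum>i\<in>J. q i x / w i * indicator (A i) y))"

lemma emeasure_cell_kernel:
  assumes q: "q \<in> cell_controls" and [measurable]: "B \<in> sets borel"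
  shows "emeasure (cell_kernel q x) B = (\<Sum>i\<in>J. ennreal (q i x) * (emeasure \<nu> (A i \<inter> B) / ennreal (w i)))"
proof -
  have [measurable]: "\<And>i. i \<in> J \<Longrightarrow> A i \<in> sets borel" by (rule A_sets)
  have q0: "0 \<le> q i x / w i" if "i \<in> J" for i
    using w_pos[OF that] cell_controls_nonneg[OF q that] by (intro divide_nonneg_pos)
  have "emeasure (cell_kernel q x) B
      = (\<integral>\<^sup>+y. ennreal (\<Sum>i\<in>J. q i x / w i * indicator (A i) y) * indicator B y \<partial>\<nu>)"
    unfolding cell_kernel_def by (rule emeasure_density) measurable
  also have "\<dots> = (\<integral>\<^sup>+y. (\<Sum>i\<in>J. ennreal (q i x / w i) * indicator (A i \<inter> B) y) \<partial>\<nu>)"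
  proof (rule nn_integral_cong)
    fix y
    have "ennreal (\<Sum>i\<in>J. q i x / w i * indicator (A i) y) = (\<Sum>i\<in>J. ennreal (q i x / w i * indicator (A i) y))"
      using q0 by (intro sum_ennreal[symmetric] mult_nonneg_nonneg) auto
    also have "\<dots> * indicator B y = (\<Sum>i\<in>J. ennreal (q i x / w i) * indicator (A i \<inter> B) y)"
      unfolding sum_distrib_right by (intro sum.cong refl) (simp split: split_indicator)
    finally show "ennreal (\<Sum>i\<in>J. q i x / w i * indicator (A i) y) * indicator B y
        = (\<Sum>i\<in>J. ennreal (q i x / w i) * indicator (A i \<inter> B) y)" .
  qed
  also have "\<dots> = (\<Sum>i\<in>J. \<integral>\<^sup>+y. ennreal (q i x / w i) * indicator (A i \<inter> B) y \<partial>\<nu>)"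
    by (rule nn_integral_sum) measurable
  also have "\<dots> = (\<Sum>i\<in>J. ennreal (q i x / w i) * emeasure \<nu> (A i \<inter> B))"
    by (intro sum.cong refl nn_integral_cmult_indicator) measurable
  also have "\<dots> = (\<Sum>i\<in>J. ennreal (q i x) * (emeasure \<nu> (A i \<inter> B) / ennreal (w i)))"
  proof (rule sum.cong[OF refl])
    fix i assume i: "i \<in> J"
    show "ennreal (q i x / w i) * emeasure \<nu> (A i \<inter> B) = ennreal (q i x) * (emeasure \<nu> (A i \<inter> B) / ennreal (w i))"
      using w_pos[OF i] cell_controls_nonneg[OF q i, of x]
      by (simp add: divide_ennreal[symmetric] ennreal_times_divide ennreal_divide_times)
  qed
  finally show ?thesis .
qed

lemma cell_kernel_transport:
  assumes q: "q \<in> cell_controls" and mass: "\<And>i. i \<in> J \<Longrightarrow> (\<integral>x. q i x \<partial>\<mu>) = w i"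
  shows "cell_kernel q \<in> transport_kernels \<mu> \<nu>"
proof -
  have [measurable]: "\<And>i. i \<in> J \<Longrightarrow> A i \<in> sets borel" by (rule A_sets)
  note [measurable] = cell_controls_measurable[OF q]
  have s: "sets (cell_kernel q x) = sets borel" for x by (simp add: cell_kernel_def sets_\<nu>)
  have "emeasure (cell_kernel q x) UNIV \<noteq> \<infinity>" for x
    unfolding emeasure_cell_kernel[OF q sets.top[of borel, unfolded space_borel]]
  proof -
    have "ennreal (q i x) * (emeasure \<nu> (A i \<inter> UNIV) / ennreal (w i)) < \<top>" if "i \<in> J" for i
      using w_pos[OF that] by (simp add: \<nu>.emeasure_eq_measure divide_ennreal ennreal_mult_less_top)
    then have "(\<Sum>i\<in>J. ennreal (q i x) * (emeasure \<nu> (A i \<inter> UNIV) / ennreal (w i))) < \<top>"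
      using fin_J by simp
    then show "(\<Sum>i\<in>J. ennreal (q i x) * (emeasure \<nu> (A i \<inter> UNIV) / ennreal (w i))) \<noteq> \<infinity>"
      by simp
  qed
  then have fin: "finite_measure (cell_kernel q x)" for x
    by (intro finite_measureI) (simp add: cell_kernel_def space_\<nu>)
  have "(\<integral>\<^sup>+x. emeasure (cell_kernel q x) B \<partial>\<mu>) = emeasure \<nu> B" if [measurable]: "B \<in> sets borel" for B
  proof -
    have "(\<integral>\<^sup>+x. emeasure (cell_kernel q x) B \<partial>\<mu>)
        = (\<Sum>i\<in>J. (\<integral>\<^sup>+x. ennreal (q i x) \<partial>\<mu>) * (emeasure \<nu> (A i \<inter> B) / ennreal (w i)))"
      unfolding emeasure_cell_kernel[OF q that] by (subst nn_integral_sum) (auto simp: nn_integral_multc)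
    also have "\<dots> = (\<Sum>i\<in>J. emeasure \<nu> (A i \<inter> B))"
    proof (rule sum.cong[OF refl])
      fix i assume i: "i \<in> J"
      have "(\<integral>\<^sup>+x. ennreal (q i x) \<partial>\<mu>) = ennreal (w i)"
        using cell_controls_integrable[OF q i] cell_controls_nonneg[OF q i] mass[OF i]
        by (subst nn_integral_eq_integral) auto
      then show "(\<integral>\<^sup>+x. ennreal (q i x) \<partial>\<mu>) * (emeasure \<nu> (A i \<inter> B) / ennreal (w i)) = emeasure \<nu> (A i \<inter> B)"
        using w_pos[OF i]
        by (simp add: \<nu>.emeasure_eq_measure divide_ennreal del: ennreal_times_divide flip: ennreal_mult)
    qed
    also have "\<dots> = emeasure \<nu> (\<Union>i\<in>J. A i \<inter> B)"
      using disj by (intro sum_emeasure fin_J) (auto simp: disjoint_family_on_def sets_\<nu>)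
    also have "\<dots> = emeasure \<nu> B"
    proof (rule emeasure_eq_AE)
      have "AE y in \<nu>. y \<in> (\<Union>i\<in>J. A i)"
        using A_full by (subst \<nu>.AE_in_set_eq_1) (auto simp: sets_\<nu> intro!: sets.finite_UN fin_J A_sets)
      then show "AE y in \<nu>. y \<in> (\<Union>i\<in>J. A i \<inter> B) \<longleftrightarrow> y \<in> B" by eventually_elim auto
    qed (auto simp: sets_\<nu> intro!: sets.finite_UN fin_J A_sets)
    finally show ?thesis .
  qed
  then show ?thesis
    using s fin by (auto simp: transport_kernels_def nonneg_kernel_def finite_borel_measures_def emeasure_cell_kernel[OF q])
qed

lemma integral_F_cell_kernel:
  assumes q: "q \<in> cell_controls"
  shows "(\<integral>y. F x y \<partial>cell_kernel q x) = (\<Sum>i\<in>J. q i x * cell_mean i x)"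
proof -
  have [measurable]: "\<And>i. i \<in> J \<Longrightarrow> A i \<in> sets borel" by (rule A_sets)
  have q0: "0 \<le> q i x / w i" if "i \<in> J" for i
    using w_pos[OF that] cell_controls_nonneg[OF q that] by (intro divide_nonneg_pos)
  have "(\<integral>y. F x y \<partial>cell_kernel q x) = (\<integral>y. (\<Sum>i\<in>J. q i x / w i * indicator (A i) y) * F x y \<partial>\<nu>)"
    unfolding cell_kernel_def
  proof (subst integral_density)
    show "AE y in \<nu>. 0 \<le> (\<Sum>i\<in>J. q i x / w i * indicator (A i) y)"
      using q0 by (intro always_eventually allI sum_nonneg mult_nonneg_nonneg) auto
  qed simp_all
  also have "\<dots> = (\<integral>y. (\<Sum>i\<in>J. q i x / w i * (indicator (A i) y * F x y)) \<partial>\<nu>)"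
    by (simp add: sum_distrib_right mult.assoc)
  also have "\<dots> = (\<Sum>i\<in>J. q i x / w i * (\<integral>y. indicator (A i) y * F x y \<partial>\<nu>))"
    using integrable_cell by (subst Bochner_Integration.integral_sum) auto
  finally show ?thesis by (simp add: cell_mean_def)
qed

text \<open>The kernel of a control with the right cell masses transports \<open>\<mu>\<close> to \<open>\<nu>\<close>, at exactly the cost of
  the control.\<close>

lemma transport_cost_le_cell_cost:
  assumes q: "q \<in> cell_controls" and mass: "\<And>i. i \<in> J \<Longrightarrow> (\<integral>x. q i x \<partial>\<mu>) = w i"
  shows "transport_cost (conical_cost G F) \<mu> \<nu> \<le> ereal (cell_cost q)"
proof -
  have "transport_cost (conical_cost G F) \<mu> \<nu> \<le> ext_integral \<mu> (\<lambda>x. conical_cost G F x (cell_kernel q x))"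
    unfolding transport_cost_def by (rule INF_lower[OF cell_kernel_transport[OF assms]])
  also have "(\<lambda>x. conical_cost G F x (cell_kernel q x))
      = (\<lambda>x. ereal (G (\<Sum>i\<in>J. q i x * cell_mean i x)) - enn2ereal 0)"
    by (simp add: conical_cost_def integral_F_cell_kernel[OF q] zero_ennreal.rep_eq)
  also have "ext_integral \<mu> \<dots> = ereal (cell_cost q)"
    using cell_cost_integrable[OF q]
    by (subst ext_integral_diff) (auto simp: cell_cost_def zero_ennreal.rep_eq)
  finally show ?thesis .
qed

end

section \<open>Duality for finitely many cells\<close>

text \<open>Finite stages for monotone convergence; each stage contains \<open>0\<close>, which keeps its value nonnegative.\<close>

lemma excess_eq_SUP_finite:
  obtains S :: "nat \<Rightarrow> real set" where "\<And>N. finite (S N)" "\<And>N. 0 \<in> S N" "\<And>N r. r \<in> S N \<Longrightarrow> 0 \<le> r"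
    "incseq S" "\<And>G s. excess G s = (SUP N. SUP r\<in>S N. ennreal (G 0 - G r - r * s))"
proof -
  let ?R = "{r::real. r \<in> \<rat> \<and> 0 \<le> r}"
  have "countable ?R" using countable_subset[OF _ countable_rat, of ?R] by auto
  moreover have "0 \<in> ?R" by simp
  ultimately obtain e :: "nat \<Rightarrow> real" where e: "?R = range e"
    using range_from_nat_into[of ?R] by (metis empty_iff)
  define S where "S N = insert 0 (e ` {..N})" for N
  have union: "(\<Union>N. S N) = ?R" unfolding e S_def using \<open>0 \<in> ?R\<close> e by auto
  show thesis
  proof (rule that[of S])
    show "finite (S N)" "0 \<in> S N" for N by (auto simp: S_def)
    show "r \<in> S N \<Longrightarrow> 0 \<le> r" for N r using union by blast
    show "incseq S" by (auto simp: incseq_def S_def)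
    show "excess G s = (SUP N. SUP r\<in>S N. ennreal (G 0 - G r - r * s))" for G s
      unfolding excess_def union[symmetric] by (rule SUP_UNION)
  qed
qed

context cell_partition
begin

lemma cell_controls_convex:
  assumes p: "p \<in> cell_controls" and q: "q \<in> cell_controls" and s: "0 \<le> s" "s \<le> 1"
  defines "r \<equiv> \<lambda>i x. (1 - s) * p i x + s * q i x"
  shows "r \<in> cell_controls" and "cell_cost r \<le> (1 - s) * cell_cost p + s * cell_cost q"
    and "i \<in> J \<Longrightarrow> (\<integral>x. r i x \<partial>\<mu>) = (1 - s) * (\<integral>x. p i x \<partial>\<mu>) + s * (\<integral>x. q i x \<partial>\<mu>)"
proof -
  note [measurable] = cell_controls_measurable[OF p] cell_controls_measurable[OF q]
  obtain B where B: "\<And>i x. i \<in> J \<Longrightarrow> p i x \<le> B i" using cell_controls_bound[OF p] by blast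
  obtain C where C: "\<And>i x. i \<in> J \<Longrightarrow> q i x \<le> C i" using cell_controls_bound[OF q] by blast
  show r: "r \<in> cell_controls"
    unfolding cell_controls_def
  proof (intro CollectI ballI conjI allI)
    fix i assume i: "i \<in> J"
    show "r i \<in> borel_measurable borel" unfolding r_def using i by measurable
    show "0 \<le> r i x" for x
      unfolding r_def using s cell_controls_nonneg[OF p i] cell_controls_nonneg[OF q i] by simp
    have "r i x \<le> (1 - s) * B i + s * C i" for x
      unfolding r_def using s B[OF i] C[OF i] by (intro add_mono mult_left_mono) auto
    then show "\<exists>B. \<forall>x. r i x \<le> B" by blast
  qed
  have "cell_cost r \<le> (\<integral>x. (1 - s) * G (\<Sum>i\<in>J. p i x * cell_mean i x) + s * G (\<Sum>i\<in>J. q i x * cell_mean i x) \<partial>\<mu>)"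
    unfolding cell_cost_def
  proof (rule integral_mono)
    fix x
    have "(\<Sum>i\<in>J. r i x * cell_mean i x)
        = (1 - s) *\<^sub>R (\<Sum>i\<in>J. p i x * cell_mean i x) + s *\<^sub>R (\<Sum>i\<in>J. q i x * cell_mean i x)"
      by (simp add: r_def sum_distrib_left sum.distrib[symmetric] algebra_simps)
    then show "G (\<Sum>i\<in>J. r i x * cell_mean i x)
        \<le> (1 - s) * G (\<Sum>i\<in>J. p i x * cell_mean i x) + s * G (\<Sum>i\<in>J. q i x * cell_mean i x)"
      using convex_onD[OF G_convex s, of "\<Sum>i\<in>J. p i x * cell_mean i x" "\<Sum>i\<in>J. q i x * cell_mean i x"]
        cell_flux(2)[OF p, of x] cell_flux(2)[OF q, of x] by simp
  qed (use cell_cost_integrable[OF p] cell_cost_integrable[OF q] cell_cost_integrable[OF r] in auto)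
  also have "\<dots> = (1 - s) * cell_cost p + s * cell_cost q"
    unfolding cell_cost_def using cell_cost_integrable[OF p] cell_cost_integrable[OF q] by simp
  finally show "cell_cost r \<le> (1 - s) * cell_cost p + s * cell_cost q" .
  show "i \<in> J \<Longrightarrow> (\<integral>x. r i x \<partial>\<mu>) = (1 - s) * (\<integral>x. p i x \<partial>\<mu>) + s * (\<integral>x. q i x \<partial>\<mu>)"
    unfolding r_def using cell_controls_integrable[OF p, of i] cell_controls_integrable[OF q, of i] by simp
qed

lemma const_cell_control: "(\<And>i. i \<in> J \<Longrightarrow> 0 \<le> c i) \<Longrightarrow> (\<lambda>i x. c i) \<in> cell_controls"
  by (auto simp: cell_controls_def)

text \<open>The only constraints are the finitely many prescribed cell masses, and constant controls provide
  the points required by Slater's condition. The multiplier \<open>l i\<close> will be the value of the dual function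
  on \<open>A i\<close>.\<close>

lemma cell_multipliers:
  assumes I: "transport_cost (conical_cost G F) \<mu> \<nu> = ereal I"
  shows "\<exists>l. \<forall>q\<in>cell_controls. I + (\<Sum>i\<in>J. l i * w i) \<le> cell_cost q + (\<Sum>i\<in>J. l i * (\<integral>x. q i x \<partial>\<mu>))"
proof -
  have "\<exists>l. \<forall>q\<in>cell_controls. I \<le> cell_cost q + (\<Sum>i\<in>J. l i * ((\<integral>x. q i x \<partial>\<mu>) - w i))"
  proof (rule lagrange_multipliers[OF fin_J])
    fix p q s assume "p \<in> cell_controls" "q \<in> cell_controls" "0 \<le> s" "s \<le> (1::real)"
    note c = cell_controls_convex[OF this]
    show "\<exists>r\<in>cell_controls. cell_cost r \<le> (1 - s) * cell_cost p + s * cell_cost q \<and>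
        (\<forall>i\<in>J. (\<integral>x. r i x \<partial>\<mu>) - w i = (1 - s) * ((\<integral>x. p i x \<partial>\<mu>) - w i) + s * ((\<integral>x. q i x \<partial>\<mu>) - w i))"
      by (rule bexI[OF _ c(1)]) (use c(2,3) in \<open>simp add: algebra_simps\<close>)
  next
    fix i assume i: "i \<in> J"
    have "(\<lambda>j x. if j = i then t else w j) \<in> cell_controls" if "0 \<le> t" for t
      using that w_pos by (intro const_cell_control) (auto intro: less_imp_le)
    then show "\<exists>p\<in>cell_controls. \<exists>q\<in>cell_controls. (\<integral>x. p i x \<partial>\<mu>) - w i < 0 \<and> 0 < (\<integral>x. q i x \<partial>\<mu>) - w i \<and>
        (\<forall>j\<in>J - {i}. (\<integral>x. p j x \<partial>\<mu>) - w j = 0 \<and> (\<integral>x. q j x \<partial>\<mu>) - w j = 0)"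
      using w_pos[OF i]
      by (intro bexI[of _ "\<lambda>j x. if j = i then 0 else w j"] bexI[of _ "\<lambda>j x. if j = i then 2 * w i else w j"])
        (auto simp: \<mu>.prob_space)
  next
    fix q assume "q \<in> cell_controls" "\<forall>i\<in>J. (\<integral>x. q i x \<partial>\<mu>) - w i = 0"
    then show "I \<le> cell_cost q" using transport_cost_le_cell_cost[of q] I by simp
  qed
  then obtain l where l: "\<And>q. q \<in> cell_controls \<Longrightarrow> I \<le> cell_cost q + (\<Sum>i\<in>J. l i * ((\<integral>x. q i x \<partial>\<mu>) - w i))"
    by blast
  have "I + (\<Sum>i\<in>J. l i * w i) \<le> cell_cost q + (\<Sum>i\<in>J. l i * (\<integral>x. q i x \<partial>\<mu>))" if "q \<in> cell_controls" for q
    using l[OF that] by (simp add: right_diff_distrib sum_subtractf)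
  then show ?thesis by blast
qed

text \<open>The multiplier inequality for the control that sends mass \<open>t\<close> from every point to one cell.
  Both estimates on multipliers below come from a choice of \<open>t\<close>.\<close>

lemma single_cell_bound:
  assumes l: "\<forall>q\<in>cell_controls. I + (\<Sum>i\<in>J. l i * w i) \<le> cell_cost q + (\<Sum>i\<in>J. l i * (\<integral>x. q i x \<partial>\<mu>))"
    and i: "i \<in> J" and t: "0 \<le> t"
  shows "I + (\<Sum>i\<in>J. l i * w i) \<le> max (G 0) (G (t * hi)) + t * l i"
proof -
  have q: "(\<lambda>j x. if j = i then t else 0) \<in> cell_controls" using t by (intro const_cell_control) auto
  have flux: "(\<Sum>j\<in>J. (if j = i then t else 0) * cell_mean j x) = t * cell_mean i x" for x
    using i fin_J by (simp add: if_distrib[of "\<lambda>c. c * _"] sum.delta cong: if_cong)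
  have "cell_cost (\<lambda>j x. if j = i then t else 0) \<le> (\<integral>x. max (G 0) (G (t * hi)) \<partial>\<mu>)"
    unfolding cell_cost_def
  proof (rule integral_mono[OF cell_cost_integrable[OF q]])
    fix x show "G (\<Sum>j\<in>J. (if j = i then t else 0) * cell_mean j x) \<le> max (G 0) (G (t * hi))"
      unfolding flux using t cell_mean_pos[OF i, of x] cell_mean_hi[OF i, of x]
      by (intro G_upper mult_left_mono) auto
  qed auto
  moreover have "(\<Sum>j\<in>J. l j * (\<integral>x. (if j = i then t else 0) \<partial>\<mu>)) = t * l i"
    using i fin_J by (simp add: \<mu>.prob_space if_distrib[of "\<lambda>c. _ * c"] sum.delta mult.commute cong: if_cong)
  ultimately show ?thesis using bspec[OF l q] by (simp add: \<mu>.prob_space)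
qed

text \<open>The weights sum to \<open>1\<close>, so the weighted sum of the multipliers is at least the smallest of them,
  \<open>l k\<close>. Sending mass \<open>2\<close> to cell \<open>k\<close> then gives \<open>I + l k \<le> max (G 0) (G (2 * hi)) + 2 * l k\<close>. The
  bound does not depend on the partition.\<close>

lemma multipliers_lower_bound:
  assumes l: "\<forall>q\<in>cell_controls. I + (\<Sum>i\<in>J. l i * w i) \<le> cell_cost q + (\<Sum>i\<in>J. l i * (\<integral>x. q i x \<partial>\<mu>))"
    and i: "i \<in> J"
  shows "I - max (G 0) (G (2 * hi)) \<le> l i"
proof -
  obtain k where k: "k \<in> J" "\<And>j. j \<in> J \<Longrightarrow> l k \<le> l j"
    using arg_min_if_finite[OF fin_J J_nonempty, of l] arg_min_least[OF fin_J J_nonempty, of _ l] by metis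
  have "l k = (\<Sum>j\<in>J. l k * w j)" by (simp add: sum_distrib_left[symmetric] sum_w)
  also have "\<dots> \<le> (\<Sum>j\<in>J. l j * w j)"
    using k w_pos by (intro sum_mono mult_right_mono) (auto intro: less_imp_le)
  finally have "I - max (G 0) (G (2 * hi)) \<le> l k"
    using single_cell_bound[OF l k(1), of 2] by simp
  then show ?thesis using k(2)[OF i] by linarith
qed

text \<open>If \<open>G\<close> is non-increasing, sending much mass costs no more than sending none; a negative
  multiplier would reward it without limit.\<close>

lemma multipliers_nonneg:
  assumes l: "\<forall>q\<in>cell_controls. I + (\<Sum>i\<in>J. l i * w i) \<le> cell_cost q + (\<Sum>i\<in>J. l i * (\<integral>x. q i x \<partial>\<mu>))"
    and i: "i \<in> J" and anti: "antimono_on {0..} G"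
  shows "0 \<le> l i"
proof (rule ccontr)
  assume neg: "\<not> 0 \<le> l i"
  define c where "c = I + (\<Sum>i\<in>J. l i * w i) - G 0"
  \<comment> \<open>enough mass for the reward to exceed what the inequality allows\<close>
  define t where "t = max 0 ((1 - c) / (- l i))"
  have "(1 - c) / (- l i) \<le> t" by (simp add: t_def)
  then have t: "0 \<le> t" "1 - c \<le> t * (- l i)"
    using neg by (simp add: t_def, subst (asm) pos_divide_le_eq) simp_all
  have "G (t * hi) \<le> G 0"
    using anti t(1) hi_pos by (auto simp: monotone_on_def)
  then have "c \<le> t * l i" using single_cell_bound[OF l i t(1)] by (simp add: c_def max_def)
  with t(2) show False by linarith
qed

text \<open>The analogue of \<^const>\<open>slope_bound\<close> for cells.\<close>

definition cell_slope :: "('i \<Rightarrow> real) \<Rightarrow> 'x \<Rightarrow> real" where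
  "cell_slope l x = (INF i\<in>J. l i / cell_mean i x)"

lemma cell_slope_measurable: "cell_slope l \<in> borel_measurable borel"
  unfolding cell_slope_def[abs_def]
  using fin_J cell_mean_measurable
  by (intro borel_measurable_cINF_real borel_measurable_divide) (auto simp: countable_finite)

lemma cell_slope_le: "i \<in> J \<Longrightarrow> cell_slope l x \<le> l i / cell_mean i x"
  unfolding cell_slope_def using fin_J by (intro cINF_lower) auto

lemma cell_slope_attained: "\<exists>i\<in>J. cell_slope l x = l i / cell_mean i x"
proof -
  have "cell_slope l x = Min ((\<lambda>i. l i / cell_mean i x) ` J)"
    unfolding cell_slope_def using fin_J J_nonempty by (intro cInf_eq_Min) auto
  moreover have "Min ((\<lambda>i. l i / cell_mean i x) ` J) \<in> (\<lambda>i. l i / cell_mean i x) ` J"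
    using fin_J J_nonempty by (intro Min_in) auto
  ultimately show ?thesis by auto
qed

text \<open>For a finite set of candidate amounts \<open>r\<close>, a measurable minimiser of \<open>G r + r * l i / cell_mean i x\<close>
  over pairs \<open>(i, r)\<close> defines the control that sends everything to cell \<open>i\<close> so as to reach
  \<open>\<integral>F x dq\<^sup>x = r\<close>. The multiplier inequality for this control is the bound for the finite stage;
  monotone convergence over the stages finishes the proof.\<close>

lemma cell_dual_bound:
  assumes l: "\<forall>q\<in>cell_controls. I + (\<Sum>i\<in>J. l i * w i) \<le> cell_cost q + (\<Sum>i\<in>J. l i * (\<integral>x. q i x \<partial>\<mu>))"
  shows "enn2ereal (\<integral>\<^sup>+x. excess G (cell_slope l x) \<partial>\<mu>) \<le> ereal (G 0 - I - (\<Sum>i\<in>J. l i * w i))"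
proof -
  define D where "D = G 0 - I - (\<Sum>i\<in>J. l i * w i)"
  obtain S :: "nat \<Rightarrow> real set" where S: "\<And>N. finite (S N)" "\<And>N. 0 \<in> S N" "\<And>N r. r \<in> S N \<Longrightarrow> 0 \<le> r"
    "incseq S" "\<And>G s. excess G s = (SUP N. SUP r\<in>S N. ennreal (G 0 - G r - r * s))"
    using excess_eq_SUP_finite by blast
  have [measurable]: "cell_slope l \<in> borel_measurable \<mu>"
    unfolding measurable_cong_sets[OF sets_\<mu> refl] by (rule cell_slope_measurable)
  define e where "e N x = (SUP r\<in>S N. ennreal (G 0 - G r - r * cell_slope l x))" for N x
  have [measurable]: "e N \<in> borel_measurable \<mu>" for N
    unfolding e_def[abs_def] using S(1) by (intro borel_measurable_SUP) (auto simp: countable_finite)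
  have "incseq e"
    using S(4) unfolding e_def incseq_def le_fun_def by (auto intro!: SUP_subset_mono)
  then have eq: "(\<integral>\<^sup>+x. excess G (cell_slope l x) \<partial>\<mu>) = (SUP N. \<integral>\<^sup>+x. e N x \<partial>\<mu>)"
    unfolding S(5) e_def[symmetric] by (intro nn_integral_monotone_convergence_SUP) auto
  have "D \<ge> 0 \<and> (\<integral>\<^sup>+x. e N x \<partial>\<mu>) \<le> ennreal D" for N
  proof -
    define P where "P = J \<times> S N"
    have P: "finite P" "P \<noteq> {}" using fin_J S(1,2) J_nonempty by (auto simp: P_def)
    define h where "h p x = G (snd p) + snd p * (l (fst p) / cell_mean (fst p) x)" for p x
    have h[measurable]: "h p \<in> borel_measurable borel" if "p \<in> P" for p
      unfolding h_def[abs_def] using cell_mean_measurable that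
      by (intro borel_measurable_add borel_measurable_times borel_measurable_divide) (auto simp: P_def)
    obtain s where s: "s \<in> borel \<rightarrow>\<^sub>M count_space P" "\<And>x. s x \<in> P" "\<And>x p. p \<in> P \<Longrightarrow> h (s x) x \<le> h p x"
      using measurable_selection_finite[OF P, of h borel] h by blast
    have sJ: "fst (s x) \<in> J" "snd (s x) \<in> S N" for x using s(2)[of x] by (auto simp: P_def)
    have hm: "(\<lambda>x. h (s x) x) \<in> borel_measurable borel"
      by (rule measurable_compose_countable'[OF h s(1) countable_finite[OF P(1)]])
    define q where "q i x = (if fst (s x) = i then snd (s x) / cell_mean i x else 0)" for i x
    have q: "q \<in> cell_controls"
      unfolding cell_controls_def
    proof (intro CollectI ballI conjI allI)
      fix i assume i: "i \<in> J"
      have "(\<lambda>x. (\<lambda>p x. if fst p = i then snd p / cell_mean i x else 0) (s x) x) \<in> borel_measurable borel"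
        by (rule measurable_compose_countable'[OF _ s(1) countable_finite[OF P(1)]])
          (use cell_mean_measurable[OF i] in auto)
      then show "q i \<in> borel_measurable borel" by (simp add: q_def[abs_def])
      show "0 \<le> q i x" for x
        unfolding q_def using S(3)[OF sJ(2)] cell_mean_pos[OF i, of x] by (auto intro: divide_nonneg_pos)
      have "q i x \<le> Max (S N) / lo" for x
      proof -
        have "snd (s x) \<le> Max (S N)" "0 \<le> Max (S N)" using S(1,2) sJ(2) by auto
        then have "snd (s x) / cell_mean i x \<le> Max (S N) / lo"
          using cell_mean_lo[OF i] lo_pos by (intro frac_le) auto
        then show ?thesis using \<open>0 \<le> Max (S N)\<close> lo_pos by (auto simp: q_def)
      qed
      then show "\<exists>B. \<forall>x. q i x \<le> B" by blast
    qed
    have flux: "(\<Sum>i\<in>J. q i x * cell_mean i x) = snd (s x)" for x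
    proof -
      have "(\<Sum>i\<in>J. q i x * cell_mean i x) = (\<Sum>i\<in>J. if fst (s x) = i then snd (s x) else 0)"
      proof (rule sum.cong[OF refl])
        fix i assume "i \<in> J"
        then show "q i x * cell_mean i x = (if fst (s x) = i then snd (s x) else 0)"
          using cell_mean_pos[of i x] by (simp add: q_def)
      qed
      then show ?thesis using fin_J sJ(1) by (simp add: sum.delta)
    qed
    have price: "(\<Sum>i\<in>J. l i * q i x) = snd (s x) * (l (fst (s x)) / cell_mean (fst (s x)) x)" for x
    proof -
      have "(\<Sum>i\<in>J. l i * q i x) = (\<Sum>i\<in>J. if fst (s x) = i then snd (s x) * (l i / cell_mean i x) else 0)"
        by (intro sum.cong refl) (simp add: q_def)
      then show ?thesis using fin_J sJ(1) by (simp add: sum.delta)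
    qed
    have hs: "h (s x) x = G (\<Sum>i\<in>J. q i x * cell_mean i x) + (\<Sum>i\<in>J. l i * q i x)" for x
      unfolding flux price h_def ..
    have int: "integrable \<mu> (\<lambda>x. h (s x) x)"
      unfolding hs using cell_cost_integrable[OF q] cell_controls_integrable[OF q] by auto
    have "(\<integral>x. h (s x) x \<partial>\<mu>) = cell_cost q + (\<Sum>i\<in>J. l i * (\<integral>x. q i x \<partial>\<mu>))"
      unfolding hs cell_cost_def using cell_cost_integrable[OF q] cell_controls_integrable[OF q]
      by (subst Bochner_Integration.integral_add) auto
    then have D: "(\<integral>x. G 0 - h (s x) x \<partial>\<mu>) \<le> D"
      using bspec[OF l q] int by (simp add: D_def \<mu>.prob_space)
    have nn: "0 \<le> G 0 - h (s x) x" for x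
      using s(3)[of "(fst (s x), 0)" x] sJ S(2) by (auto simp: P_def h_def)
    have "0 \<le> (\<integral>x. G 0 - h (s x) x \<partial>\<mu>)" using nn by (intro integral_nonneg_AE) auto
    moreover have "(\<integral>\<^sup>+x. e N x \<partial>\<mu>) \<le> (\<integral>\<^sup>+x. ennreal (G 0 - h (s x) x) \<partial>\<mu>)"
    proof (rule nn_integral_mono)
      fix x
      obtain i where i: "i \<in> J" "cell_slope l x = l i / cell_mean i x" using cell_slope_attained by blast
      show "e N x \<le> ennreal (G 0 - h (s x) x)"
        unfolding e_def
      proof (rule SUP_least)
        fix r assume "r \<in> S N"
        then have "h (s x) x \<le> G r + r * cell_slope l x"
          using s(3)[of "(i, r)" x] i by (simp add: P_def h_def)
        then show "ennreal (G 0 - G r - r * cell_slope l x) \<le> ennreal (G 0 - h (s x) x)"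
          by (intro ennreal_leI) simp
      qed
    qed
    moreover have "(\<integral>\<^sup>+x. ennreal (G 0 - h (s x) x) \<partial>\<mu>) = ennreal (\<integral>x. G 0 - h (s x) x \<partial>\<mu>)"
      using int nn by (intro nn_integral_eq_integral) auto
    ultimately show ?thesis using D by (auto intro: order_trans ennreal_leI)
  qed
  then have "0 \<le> D" "(SUP N. \<integral>\<^sup>+x. e N x \<partial>\<mu>) \<le> ennreal D" by (auto intro: SUP_least)
  then show ?thesis unfolding eq D_def[symmetric] by (simp add: less_eq_ennreal.rep_eq enn2ereal_ennreal)
qed

end

section \<open>Truncation, fine partitions, and lifting from cells\<close>

text \<open>The lower limit of a real sequence bounded below by \<open>- M\<close>. The shift by \<open>M\<close> moves the computation to
  \<^typ>\<open>ennreal\<close>, where measurability of lower limits and Fatou's lemma are available.\<close>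

definition real_liminf :: "real \<Rightarrow> (nat \<Rightarrow> real) \<Rightarrow> real" where
  "real_liminf M a = enn2real (liminf (\<lambda>n. ennreal (a n + M))) - M"

lemma ennreal_real_liminf:
  assumes "\<And>n. - M \<le> a n" "\<And>n. a n \<le> U"
  shows "ennreal (real_liminf M a + M) = liminf (\<lambda>n. ennreal (a n + M))"
    and "- M \<le> real_liminf M a"
proof -
  have "liminf (\<lambda>n. ennreal (a n + M)) \<le> liminf (\<lambda>n. ennreal (U + M))"
    using assms(2) by (intro Liminf_mono always_eventually allI ennreal_leI) simp
  also have "\<dots> < \<top>" by (simp add: Liminf_const)
  finally show "ennreal (real_liminf M a + M) = liminf (\<lambda>n. ennreal (a n + M))"
    by (simp add: real_liminf_def)
  show "- M \<le> real_liminf M a" by (simp add: real_liminf_def)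
qed

lemma real_liminf_ge:
  assumes a: "\<And>n. - M \<le> a n" "\<And>n. a n \<le> U" and b: "\<And>n. b n \<le> a n" "b \<longlonglongrightarrow> l"
  shows "l \<le> real_liminf M a"
proof -
  have "(\<lambda>n. ennreal (b n + M)) \<longlonglongrightarrow> ennreal (l + M)" using b(2) by (intro tendsto_intros)
  then have "ennreal (l + M) = liminf (\<lambda>n. ennreal (b n + M))"
    by (intro lim_imp_Liminf[symmetric]) auto
  also have "\<dots> \<le> liminf (\<lambda>n. ennreal (a n + M))"
    using b(1) by (intro Liminf_mono always_eventually allI ennreal_leI) simp
  finally have "ennreal (l + M) \<le> ennreal (real_liminf M a + M)"
    using ennreal_real_liminf(1)[of M a, OF a] by simp
  then show ?thesis using ennreal_real_liminf(2)[of M a, OF a] by (simp add: ennreal_le_iff)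
qed

lemma real_liminf_le:
  assumes a: "\<And>n. - M \<le> a n" "\<And>n. a n \<le> U" and b: "\<And>n. a n \<le> b n" "b \<longlonglongrightarrow> l"
  shows "real_liminf M a \<le> l"
proof -
  have "- M \<le> l" using a(1) b by (intro LIMSEQ_le_const[OF b(2)]) (auto intro: order_trans)
  have "(\<lambda>n. ennreal (b n + M)) \<longlonglongrightarrow> ennreal (l + M)" using b(2) by (intro tendsto_intros)
  then have "ennreal (l + M) = liminf (\<lambda>n. ennreal (b n + M))"
    by (intro lim_imp_Liminf[symmetric]) auto
  also have "\<dots> \<ge> liminf (\<lambda>n. ennreal (a n + M))"
    using b(1) by (intro Liminf_mono always_eventually allI ennreal_leI) simp
  finally have "ennreal (real_liminf M a + M) \<le> ennreal (l + M)"
    using ennreal_real_liminf(1)[of M a, OF a] by simp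
  then show ?thesis using \<open>- M \<le> l\<close> by (simp add: ennreal_le_iff)
qed

context conical_transport
begin

text \<open>Once the price \<open>t\<close> exceeds \<open>- g\<close>, the function \<open>u \<mapsto> G u + t * u\<close> is non-decreasing on the positive
  half-line, so it stays above its limit at \<open>0\<close>. That limit does not depend on the price, and small
  amounts come arbitrarily close to it at the price \<open>s\<close> too. This is where a
  finite slope at \<open>0\<close> helps: it caps the dual function from above.\<close>

lemma excess_truncate:
  assumes g: "\<And>v u. 0 < v \<Longrightarrow> v \<le> u \<Longrightarrow> G v - g * v \<le> G u - g * u" and t: "- g \<le> t"
  shows "excess G t \<le> excess G s"
  unfolding excess_def[of G t]
proof (rule SUP_least)
  fix r assume "r \<in> {r \<in> \<rat>. 0 \<le> (r::real)}"
  then have r: "0 \<le> r" by simp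
  show "ennreal (G 0 - G r - r * t) \<le> excess G s"
  proof (cases "r = 0")
    case True
    then show ?thesis by simp
  next
    case False
    define X where "X = G 0 - G r - r * t"
    have lim: "((\<lambda>v. ennreal (X - v * (g + s))) \<longlongrightarrow> ennreal (X - 0 * (g + s))) (at_right 0)"
      by (intro tendsto_intros)
    have "eventually (\<lambda>v. ennreal (X - v * (g + s)) \<le> excess G s) (at_right 0)"
    proof (rule eventually_at_rightI[of 0 r])
      fix v assume v: "v \<in> {0<..<r}"
      have "r * (- g) \<le> r * t" using t r by (rule mult_left_mono)
      moreover have "G v - g * v \<le> G r - g * r" using g[of v r] v by simp
      ultimately have "X - v * (g + s) \<le> G 0 - G v - v * s" by (simp add: X_def algebra_simps)
      then have "ennreal (X - v * (g + s)) \<le> ennreal (G 0 - G v - v * s)" by (rule ennreal_leI)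
      also have "\<dots> \<le> excess G s" using v by (intro excess_upper) auto
      finally show "ennreal (X - v * (g + s)) \<le> excess G s" .
    qed (use r False in auto)
    from tendsto_upperbound[OF lim this] show ?thesis by (simp add: X_def)
  qed
qed

lemma excess_liminf:
  assumes "(\<lambda>n. s n) \<longlonglongrightarrow> t"
  shows "excess G t \<le> liminf (\<lambda>n. excess G (s n))"
  unfolding excess_def[of G t]
proof (rule SUP_least)
  fix r assume r: "r \<in> {r \<in> \<rat>. 0 \<le> (r::real)}"
  have "(\<lambda>n. ennreal (G 0 - G r - r * s n)) \<longlonglongrightarrow> ennreal (G 0 - G r - r * t)"
    using assms by (intro tendsto_intros)
  then have "ennreal (G 0 - G r - r * t) = liminf (\<lambda>n. ennreal (G 0 - G r - r * s n))"
    by (intro lim_imp_Liminf[symmetric]) auto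
  also have "\<dots> \<le> liminf (\<lambda>n. excess G (s n))"
    using r by (intro Liminf_mono always_eventually allI excess_upper) auto
  finally show "ennreal (G 0 - G r - r * t) \<le> liminf (\<lambda>n. excess G (s n))" .
qed

lemma cell_partition_positive:
  assumes K: "finite K" "\<And>i. i \<in> K \<Longrightarrow> A i \<in> sets borel" "disjoint_family_on A K" "(\<Union>i\<in>K. A i) = UNIV"
  shows "cell_partition F G \<mu> \<nu> lo hi {i\<in>K. 0 < measure \<nu> (A i)} A"
proof unfold_locales
  interpret \<nu>: prob_space \<nu> by (rule prob_\<nu>)
  let ?J = "{i\<in>K. 0 < measure \<nu> (A i)}"
  show "finite ?J" using K(1) by simp
  show "i \<in> ?J \<Longrightarrow> A i \<in> sets borel" "i \<in> ?J \<Longrightarrow> 0 < measure \<nu> (A i)" for i using K(2) by auto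
  show disj: "disjoint_family_on A ?J" using K(3) by (rule disjoint_family_on_mono[rotated]) auto
  have "measure \<nu> (\<Union>i\<in>?J. A i) = (\<Sum>i\<in>?J. measure \<nu> (A i))"
    using K(1,2) disj by (intro \<nu>.finite_measure_finite_Union) (auto simp: sets_\<nu>)
  also have "\<dots> = (\<Sum>i\<in>K. measure \<nu> (A i))"
    using K(1) by (intro sum.mono_neutral_left) (auto simp: zero_less_measure_iff not_less)
  also have "\<dots> = measure \<nu> (\<Union>i\<in>K. A i)"
    using K by (intro \<nu>.finite_measure_finite_Union[symmetric]) (auto simp: sets_\<nu>)
  also have "\<dots> = 1" using \<nu>.prob_space by (simp add: K(4) space_\<nu>)
  finally show "measure \<nu> (\<Union>i\<in>?J. A i) = 1" .
qed

text \<open>Uniform continuity of \<open>F\<close>, a finite cover by small balls, made disjoint.\<close>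

lemma fine_cell_partition:
  assumes "0 < \<delta>"
  obtains J :: "nat set" and A where "cell_partition F G \<mu> \<nu> lo hi J A"
    "\<And>i x y y'. i \<in> J \<Longrightarrow> y \<in> A i \<Longrightarrow> y' \<in> A i \<Longrightarrow> \<bar>F x y - F x y'\<bar> \<le> \<delta>"
proof -
  obtain d where d: "d > 0" "\<And>x x' y y'. dist x x' < d \<Longrightarrow> dist y y' < d \<Longrightarrow> \<bar>F x y - F x' y'\<bar> < \<delta>"
    using F_uniform[OF assms] by blast
  have "(UNIV :: 'y set) \<subseteq> (\<Union>y\<in>UNIV. ball y (d / 2))"
  proof
    fix y :: 'y
    have "y \<in> ball y (d / 2)" using d(1) by simp
    then show "y \<in> (\<Union>y\<in>UNIV. ball y (d / 2))" by blast
  qed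
  then obtain K :: "'y set" where K: "finite K" "UNIV \<subseteq> (\<Union>y\<in>K. ball y (d / 2))"
    using compactE_image[OF compact_Y, of UNIV "\<lambda>y. ball y (d / 2)"] open_ball by metis
  obtain e where e: "bij_betw e {0..<card K} K" using ex_bij_betw_nat_finite[OF K(1)] by blast
  define D where "D n = ball (e n) (d / 2)" for n
  define A where "A = disjointed D"
  have sub: "A n \<subseteq> D n" for n unfolding A_def by (rule disjointed_subset)
  have "(\<Union>n\<in>{0..<card K}. A n) = (\<Union>n\<in>{0..<card K}. D n)"
    unfolding A_def by (rule finite_UN_disjointed_eq)
  also have "\<dots> = (\<Union>y\<in>e ` {0..<card K}. ball y (d / 2))" by (simp add: D_def)
  also have "\<dots> = UNIV" using K(2) e by (auto simp: bij_betw_def)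
  finally have un: "(\<Union>n\<in>{0..<card K}. A n) = UNIV" .
  have meas: "A n \<in> sets borel" for n
    unfolding A_def disjointed_def D_def by (intro sets.Diff sets.finite_UN) auto
  have "disjoint_family_on A {0..<card K}"
    unfolding A_def using disjoint_family_disjointed by (rule disjoint_family_on_mono[rotated]) auto
  from cell_partition_positive[OF _ meas this un]
  have part: "cell_partition F G \<mu> \<nu> lo hi {n\<in>{0..<card K}. 0 < measure \<nu> (A n)} A" by simp
  have "\<bar>F x y - F x y'\<bar> \<le> \<delta>" if "y \<in> A n" "y' \<in> A n" for n x y y'
  proof -
    have "dist (e n) y < d / 2" "dist (e n) y' < d / 2" using that sub[of n] by (auto simp: D_def)
    then have "dist y y' < d" using dist_triangle2[of y y' "e n"] by (simp add: dist_commute)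
    then show ?thesis using d(2)[of x x y y'] d(1) by simp
  qed
  with part show thesis by (rule that)
qed

end

context cell_partition
begin

text \<open>The step function with value \<open>l i\<close> on \<open>A i\<close>. The value \<open>c\<close> on the remaining \<open>\<nu>\<close>-null set does not enter
  integrals, and is chosen large enough not to lower the slope bound.\<close>

definition cell_lift :: "('i \<Rightarrow> real) \<Rightarrow> real \<Rightarrow> 'y \<Rightarrow> real" where
  "cell_lift l c y = (if y \<in> (\<Union>i\<in>J. A i) then \<Sum>i\<in>J. l i * indicator (A i) y else c)"

lemma cell_lift_eq:
  assumes "i \<in> J" "y \<in> A i"
  shows "cell_lift l c y = l i"
proof -
  have "indicator (A j) y = (if j = i then 1 else (0::real))" if "j \<in> J" for j
    using assms that disj unfolding disjoint_family_on_def by (auto simp: indicator_def)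
  then have "(\<Sum>j\<in>J. l j * indicator (A j) y) = (\<Sum>j\<in>J. if j = i then l j else 0)"
    by (intro sum.cong) auto
  also have "\<dots> = l i" using assms(1) fin_J by simp
  finally show ?thesis using assms by (auto simp: cell_lift_def)
qed

lemma cell_lift_cases:
  obtains i where "i \<in> J" "y \<in> A i" "cell_lift l c y = l i" | "y \<notin> (\<Union>i\<in>J. A i)" "cell_lift l c y = c"
  using cell_lift_eq cell_lift_def by (metis UN_E)

lemma cell_lift_measurable: "cell_lift l c \<in> borel_measurable borel"
proof -
  have [measurable]: "\<And>i. i \<in> J \<Longrightarrow> A i \<in> sets borel" by (rule A_sets)
  have [measurable]: "(\<Union>i\<in>J. A i) \<in> sets borel" using fin_J by (intro sets.finite_UN) auto
  show ?thesis unfolding cell_lift_def[abs_def] by measurable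
qed

lemma integral_cell_lift: "(\<integral>y. cell_lift l c y \<partial>\<nu>) = (\<Sum>i\<in>J. l i * w i)"
proof -
  have [measurable]: "\<And>i. i \<in> J \<Longrightarrow> A i \<in> sets borel" by (rule A_sets)
  have "AE y in \<nu>. y \<in> (\<Union>i\<in>J. A i)"
    using A_full by (subst \<nu>.AE_in_set_eq_1) (auto simp: sets_\<nu> intro!: sets.finite_UN fin_J A_sets)
  then have "AE y in \<nu>. cell_lift l c y = (\<Sum>i\<in>J. indicator (A i) y * l i)"
    by eventually_elim (auto simp: cell_lift_def mult.commute)
  then have "(\<integral>y. cell_lift l c y \<partial>\<nu>) = (\<integral>y. (\<Sum>i\<in>J. indicator (A i) y * l i) \<partial>\<nu>)"
    using cell_lift_measurable by (intro integral_cong_AE) (auto simp: measurable_cong_sets[OF sets_\<nu> refl])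
  also have "\<dots> = (\<Sum>i\<in>J. w i * l i)"
    by (subst Bochner_Integration.integral_sum)
      (assumption | rule integrable_cell_const sum.cong integral_cell_const refl)+
  finally show ?thesis by (simp add: mult.commute)
qed

lemma abs_cell_slope_le:
  assumes B: "\<And>i. i \<in> J \<Longrightarrow> \<bar>l i\<bar> \<le> B"
  shows "\<bar>cell_slope l x\<bar> \<le> B / lo"
proof -
  obtain i where i: "i \<in> J" "cell_slope l x = l i / cell_mean i x" using cell_slope_attained by blast
  then show ?thesis
    using B[OF i(1)] cell_mean_lo[OF i(1), of x] lo_pos by (auto simp: abs_divide intro!: frac_le)
qed

text \<open>Replacing \<open>F x y\<close> by its cell mean changes \<open>\<phi> x * F x y\<close> by at most \<open>\<delta> * \<bar>\<phi> x\<bar>\<close>, with \<open>\<bar>\<phi> x\<bar> \<le> B / lo\<close>;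
  raising the multipliers by that amount absorbs the error.\<close>

lemma cell_slope_lift:
  assumes B: "\<And>i. i \<in> J \<Longrightarrow> \<bar>l i\<bar> \<le> B" and C: "\<And>i. i \<in> J \<Longrightarrow> l i \<le> C" "0 \<le> C"
    and osc: "\<And>i x y y'. i \<in> J \<Longrightarrow> y \<in> A i \<Longrightarrow> y' \<in> A i \<Longrightarrow> \<bar>F x y - F x y'\<bar> \<le> \<delta>"
  shows "cell_slope l x * F x y \<le> cell_lift (\<lambda>i. l i + B / lo * \<delta>) (C / lo * hi) y"
proof (cases rule: cell_lift_cases[of y "\<lambda>i. l i + B / lo * \<delta>" "C / lo * hi"])
  case (1 i)
  have "F x y - \<delta> \<le> cell_mean i x"
    using osc[OF 1(1,2)] by (intro cell_mean_ge[OF 1(1)]) (auto simp: abs_le_iff algebra_simps)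
  moreover have "cell_mean i x \<le> F x y + \<delta>"
    using osc[OF 1(1) _ 1(2)] by (intro cell_mean_le[OF 1(1)]) (auto simp: abs_le_iff algebra_simps)
  ultimately have close: "\<bar>F x y - cell_mean i x\<bar> \<le> \<delta>" by linarith
  have "cell_slope l x * F x y = cell_slope l x * cell_mean i x + cell_slope l x * (F x y - cell_mean i x)"
    by (simp add: algebra_simps)
  also have "cell_slope l x * cell_mean i x \<le> l i"
    using cell_slope_le[OF 1(1), of l x] cell_mean_pos[OF 1(1), of x] by (simp add: pos_le_divide_eq)
  also have "cell_slope l x * (F x y - cell_mean i x) \<le> \<bar>cell_slope l x\<bar> * \<bar>F x y - cell_mean i x\<bar>"
    by (simp add: abs_mult[symmetric])
  also have "\<dots> \<le> B / lo * \<delta>"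
    using abs_cell_slope_le[of l B x, OF B] close by (intro mult_mono) auto
  finally show ?thesis unfolding 1(3) by simp
next
  case 2
  obtain i where i: "i \<in> J" "cell_slope l x = l i / cell_mean i x" using cell_slope_attained by blast
  have "cell_slope l x \<le> C / lo"
    unfolding i(2) using C(1)[OF i(1)] C(2) cell_mean_lo[OF i(1), of x] lo_pos by (intro frac_le) auto
  then have "cell_slope l x * F x y \<le> C / lo * F x y"
    using F_pos[of x y] by (intro mult_right_mono) auto
  also have "\<dots> \<le> C / lo * hi"
    using F_hi[of x y] C(2) lo_pos by (intro mult_left_mono) auto
  finally show ?thesis unfolding 2(2) .
qed

lemma cell_slope_equicontinuous:
  assumes B: "\<And>i. i \<in> J \<Longrightarrow> \<bar>l i\<bar> \<le> B" and d: "\<And>y. \<bar>F x y - F x' y\<bar> \<le> d"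
  shows "cell_slope l x' \<le> cell_slope l x + B * d / lo\<^sup>2"
  unfolding cell_slope_def
  by (rule INF_quotient_le[OF J_nonempty lo_pos B]) (use cell_mean_lo cell_mean_diff[OF _ d] in auto)

text \<open>A multiplier above \<open>C\<close> prices every point at more than \<open>- g\<close>, where \<open>excess_truncate\<close> applies.\<close>

lemma excess_cell_slope_truncate:
  assumes g: "\<And>v u. 0 < v \<Longrightarrow> v \<le> u \<Longrightarrow> G v - g * v \<le> G u - g * u"
    and C: "C = max 0 (- g) * hi"
  shows "excess G (cell_slope (\<lambda>i. min (l i) C) x) \<le> excess G (cell_slope l x)"
proof -
  obtain i where i: "i \<in> J" "cell_slope (\<lambda>i. min (l i) C) x = min (l i) C / cell_mean i x"
    using cell_slope_attained by blast
  show ?thesis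
  proof (cases "l i \<le> C")
    case True
    then show ?thesis using i cell_slope_le[OF i(1), of l x] by (intro excess_antimono) simp
  next
    case False
    have "- g * cell_mean i x \<le> max 0 (- g) * cell_mean i x"
      using cell_mean_pos[OF i(1), of x] by (intro mult_right_mono) auto
    also have "\<dots> \<le> C" unfolding C using cell_mean_hi[OF i(1), of x] by (intro mult_left_mono) auto
    finally have "- g \<le> cell_slope (\<lambda>i. min (l i) C) x"
      using False i(2) cell_mean_pos[OF i(1), of x] by (simp add: pos_le_divide_eq)
    with g show ?thesis by (rule excess_truncate)
  qed
qed

end

context conical_transport
begin

section \<open>Existence of dual optimisers\<close>

text \<open>The bounds are uniform for bounded \<open>\<delta>\<close>, and the modulus of continuity of \<open>\<phi>\<close> depends on \<open>F\<close> alone: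
  this is the compactness needed to let \<open>\<delta>\<close> tend to \<open>0\<close>.\<close>

lemma near_optimal_pair:
  assumes I: "transport_cost (conical_cost G F) \<mu> \<nu> = ereal I"
    and g: "\<And>v u. 0 < v \<Longrightarrow> v \<le> u \<Longrightarrow> G v - g * v \<le> G u - g * u"
    and \<delta>: "0 < \<delta>"
  defines "C \<equiv> max 0 (- g) * hi"
  defines "B \<equiv> max \<bar>I - max (G 0) (G (2 * hi))\<bar> C"
  shows "\<exists>f \<phi>. f \<in> borel_measurable borel \<and> \<phi> \<in> borel_measurable borel \<and>
    (\<forall>y. - B \<le> f y \<and> f y \<le> C / lo * hi + B / lo * \<delta>) \<and> (antimono_on {0..} G \<longrightarrow> (\<forall>y. 0 \<le> f y)) \<and>
    (\<forall>x. \<bar>\<phi> x\<bar> \<le> B / lo) \<and>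
    (\<forall>x x' d. (\<forall>y. \<bar>F x y - F x' y\<bar> \<le> d) \<longrightarrow> \<phi> x' \<le> \<phi> x + B * d / lo\<^sup>2) \<and>
    (\<forall>x y. \<phi> x * F x y \<le> f y) \<and>
    enn2ereal (\<integral>\<^sup>+x. excess G (\<phi> x) \<partial>\<mu>) \<le> ereal (G 0 - I - (\<integral>y. f y \<partial>\<nu>) + B / lo * \<delta>)"
proof -
  obtain J :: "nat set" and A where part: "cell_partition F G \<mu> \<nu> lo hi J A"
    and osc: "\<And>i x y y'. i \<in> J \<Longrightarrow> y \<in> A i \<Longrightarrow> y' \<in> A i \<Longrightarrow> \<bar>F x y - F x y'\<bar> \<le> \<delta>"
    using fine_cell_partition[OF \<delta>] by metis
  interpret cell_partition F G \<mu> \<nu> lo hi J A by (rule part)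
  obtain l where l: "\<forall>q\<in>cell_controls. I + (\<Sum>i\<in>J. l i * w i) \<le> cell_cost q + (\<Sum>i\<in>J. l i * (\<integral>x. q i x \<partial>\<mu>))"
    using cell_multipliers[OF I] by blast
  \<comment> \<open>truncation lowers \<open>\<integral>f d\<nu>\<close> and, by \<open>excess_truncate\<close>, does not increase the other term\<close>
  define l' where "l' i = min (l i) C" for i
  have C0: "0 \<le> C" using hi_pos by (simp add: C_def)
  have B0: "0 \<le> B" by (simp add: B_def)
  have lB: "\<bar>l' i\<bar> \<le> B" if "i \<in> J" for i
    using multipliers_lower_bound[OF l that] C0 by (auto simp: l'_def B_def)
  have lC: "l' i \<le> C" for i by (simp add: l'_def)
  define \<phi> where "\<phi> = cell_slope l'"
  define f where "f = cell_lift (\<lambda>i. l' i + B / lo * \<delta>) (C / lo * hi)"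
  have e0: "0 \<le> B / lo * \<delta>" using B0 lo_pos \<delta> by simp
  have "lo \<le> hi" using F_lo F_hi by (meson order_trans)
  then have CC: "C \<le> C / lo * hi" using C0 lo_pos by (simp add: pos_le_divide_eq mult_left_mono)
  have 1: "f \<in> borel_measurable borel" unfolding f_def by (rule cell_lift_measurable)
  have 2: "\<phi> \<in> borel_measurable borel" unfolding \<phi>_def by (rule cell_slope_measurable)
  have 3: "- B \<le> f y \<and> f y \<le> C / lo * hi + B / lo * \<delta>" for y
    unfolding f_def
  proof (cases rule: cell_lift_cases[of y "\<lambda>i. l' i + B / lo * \<delta>" "C / lo * hi"])
    case (1 i)
    then show "- B \<le> cell_lift (\<lambda>i. l' i + B / lo * \<delta>) (C / lo * hi) y \<and>
        cell_lift (\<lambda>i. l' i + B / lo * \<delta>) (C / lo * hi) y \<le> C / lo * hi + B / lo * \<delta>"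
      using lB[OF 1(1)] lC[of i] e0 CC by auto
  next
    case 2
    then show "- B \<le> cell_lift (\<lambda>i. l' i + B / lo * \<delta>) (C / lo * hi) y \<and>
        cell_lift (\<lambda>i. l' i + B / lo * \<delta>) (C / lo * hi) y \<le> C / lo * hi + B / lo * \<delta>"
      using B0 e0 C0 CC by auto
  qed
  have 4: "0 \<le> f y" if "antimono_on {0..} G" for y
    unfolding f_def
  proof (cases rule: cell_lift_cases[of y "\<lambda>i. l' i + B / lo * \<delta>" "C / lo * hi"])
    case (1 i)
    then show "0 \<le> cell_lift (\<lambda>i. l' i + B / lo * \<delta>) (C / lo * hi) y"
      using multipliers_nonneg[OF l 1(1) that] C0 e0 by (auto simp: l'_def)
  next
    case 2
    then show "0 \<le> cell_lift (\<lambda>i. l' i + B / lo * \<delta>) (C / lo * hi) y" using C0 CC by auto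
  qed
  have 5: "\<bar>\<phi> x\<bar> \<le> B / lo" for x unfolding \<phi>_def by (rule abs_cell_slope_le[OF lB])
  have 6: "\<phi> x' \<le> \<phi> x + B * d / lo\<^sup>2" if "\<forall>y. \<bar>F x y - F x' y\<bar> \<le> d" for x x' d
    unfolding \<phi>_def using that by (intro cell_slope_equicontinuous lB) auto
  have 7: "\<phi> x * F x y \<le> f y" for x y
    unfolding \<phi>_def f_def by (rule cell_slope_lift[OF lB lC C0 osc])
  have "(\<integral>y. f y \<partial>\<nu>) = (\<Sum>i\<in>J. l' i * w i) + B / lo * \<delta>"
    unfolding f_def integral_cell_lift
    unfolding distrib_right sum.distrib sum_distrib_left[symmetric] sum_w by simp
  also have "(\<Sum>i\<in>J. l' i * w i) \<le> (\<Sum>i\<in>J. l i * w i)"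
    using w_pos by (intro sum_mono mult_right_mono) (auto simp: l'_def intro: less_imp_le)
  finally have int: "(\<integral>y. f y \<partial>\<nu>) \<le> (\<Sum>i\<in>J. l i * w i) + B / lo * \<delta>" by simp
  have "(\<integral>\<^sup>+x. excess G (\<phi> x) \<partial>\<mu>) \<le> (\<integral>\<^sup>+x. excess G (cell_slope l x) \<partial>\<mu>)"
    unfolding \<phi>_def l'_def
  proof (rule nn_integral_mono)
    fix x
    show "excess G (cell_slope (\<lambda>i. min (l i) C) x) \<le> excess G (cell_slope l x)"
      by (rule excess_cell_slope_truncate[of g]) (fact g, simp add: C_def)
  qed
  then have "enn2ereal (\<integral>\<^sup>+x. excess G (\<phi> x) \<partial>\<mu>) \<le> ereal (G 0 - I - (\<Sum>i\<in>J. l i * w i))"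
    using cell_dual_bound[OF l] by (meson less_eq_ennreal.rep_eq order_trans)
  also have "\<dots> \<le> ereal (G 0 - I - (\<integral>y. f y \<partial>\<nu>) + B / lo * \<delta>)" using int by simp
  finally have 8: "enn2ereal (\<integral>\<^sup>+x. excess G (\<phi> x) \<partial>\<mu>) \<le> ereal (G 0 - I - (\<integral>y. f y \<partial>\<nu>) + B / lo * \<delta>)" .
  show ?thesis using 1 2 3 4 5 6 7 8 by blast
qed

text \<open>The argument of Arzela and Ascoli for pointwise limits. The real sequence \<open>c\<close> is carried along as one
  additional coordinate, \<^const>\<open>None\<close>, of the diagonal argument.\<close>

lemma equicontinuous_subsequence:
  assumes bdd: "\<And>n x. \<bar>\<phi> n x\<bar> \<le> M" "\<And>n. \<bar>c n\<bar> \<le> M" and L: "0 \<le> L"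
    and eq: "\<And>n x x' d. (\<forall>y. \<bar>F x y - F x' y\<bar> \<le> d) \<Longrightarrow> \<phi> n x' \<le> \<phi> n x + L * d"
  obtains k :: "nat \<Rightarrow> nat" and \<psi> b where "strict_mono k" "\<And>x. (\<lambda>n. \<phi> (k n) x) \<longlonglongrightarrow> \<psi> x"
    "(\<lambda>n. c (k n)) \<longlonglongrightarrow> (b::real)"
proof -
  have "\<exists>D::'x set. countable D \<and> (\<forall>U. open U \<longrightarrow> U \<noteq> {} \<longrightarrow> (\<exists>z\<in>D. z \<in> U))"
    by (rule countable_dense_exists)
  then obtain D :: "'x set" where dense: "countable D \<and> (\<forall>U. open U \<longrightarrow> U \<noteq> {} \<longrightarrow> (\<exists>z\<in>D. z \<in> U))"
    by (rule exE)
  have D: "\<exists>z\<in>D. z \<in> U" if "open U" "U \<noteq> {}" for U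
    using dense that by blast
  define H where "H n z = (case z of None \<Rightarrow> c n | Some x \<Rightarrow> \<phi> n x)" for n z
  have H_bdd: "norm (H n z) \<le> M" for n z using bdd by (cases z) (auto simp: H_def)
  have countable: "countable (insert None (Some ` D))" using dense by simp
  obtain k where k: "strict_mono k"
    "\<And>z. z \<in> insert None (Some ` D) \<Longrightarrow> \<exists>l. (\<lambda>n. H (k n) z) \<longlonglongrightarrow> l"
    using function_convergent_subsequence[of "insert None (Some ` D)" H M, OF countable H_bdd] by metis
  have "Cauchy (\<lambda>n. \<phi> (k n) x)" for x
  proof (rule CauchyI)
    fix e :: real assume e: "0 < e"
    \<comment> \<open>with this accuracy for \<open>F\<close>, each \<open>\<phi> n\<close> moves by at most \<open>e / 4\<close>\<close>
    define d0 where "d0 = e / (4 * (L + 1))"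
    have d0: "0 < d0" using e L by (simp add: d0_def)
    have "L * d0 = e / 4 * (L / (L + 1))" using L by (simp add: d0_def)
    also have "\<dots> \<le> e / 4 * 1" using e L by (intro mult_left_mono) auto
    finally have Ld: "L * d0 \<le> e / 4" by simp
    obtain d where d: "d > 0" "\<And>x x' y y'. dist x x' < d \<Longrightarrow> dist y y' < d \<Longrightarrow> \<bar>F x y - F x' y'\<bar> < d0"
      using F_uniform[OF d0] by blast
    have "x \<in> ball x d" using d(1) by simp
    then obtain z where z: "z \<in> D" "z \<in> ball x d" using D[of "ball x d"] by auto
    have "\<forall>y. \<bar>F x y - F z y\<bar> \<le> d0" "\<forall>y. \<bar>F z y - F x y\<bar> \<le> d0"
      using d z by (auto intro!: less_imp_le simp: dist_commute)
    then have "\<phi> n z \<le> \<phi> n x + L * d0" "\<phi> n x \<le> \<phi> n z + L * d0" for n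
      by (auto intro: eq)
    then have near: "\<bar>\<phi> n x - \<phi> n z\<bar> \<le> e / 4" for n
      using Ld by (smt (verit) abs_le_iff)
    obtain l where "(\<lambda>n. H (k n) (Some z)) \<longlonglongrightarrow> l" using k(2) z(1) by blast
    then have "Cauchy (\<lambda>n. \<phi> (k n) z)" by (auto simp: H_def intro: LIMSEQ_imp_Cauchy)
    then obtain N where N: "\<And>m n. m \<ge> N \<Longrightarrow> n \<ge> N \<Longrightarrow> norm (\<phi> (k m) z - \<phi> (k n) z) < e / 4"
      using e by (metis CauchyD divide_pos_pos zero_less_numeral)
    have "norm (\<phi> (k m) x - \<phi> (k n) x) < e" if "m \<ge> N" "n \<ge> N" for m n
      using N[OF that] near[of "k m"] near[of "k n"] e unfolding real_norm_def by linarith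
    then show "\<exists>N. \<forall>m\<ge>N. \<forall>n\<ge>N. norm (\<phi> (k m) x - \<phi> (k n) x) < e" by blast
  qed
  then have "\<forall>x. \<exists>l. (\<lambda>n. \<phi> (k n) x) \<longlonglongrightarrow> l"
    using Cauchy_convergent_iff convergent_def by blast
  then obtain \<psi> where "\<And>x. (\<lambda>n. \<phi> (k n) x) \<longlonglongrightarrow> \<psi> x" by metis
  moreover obtain b where "(\<lambda>n. c (k n)) \<longlonglongrightarrow> b" using k(2)[of None] by (auto simp: H_def)
  ultimately show thesis using k(1) that by blast
qed

text \<open>The near-optimal \<open>\<phi> n\<close> converge pointwise along a subsequence. The \<open>f n\<close> are replaced by their
  lower limit \<open>h\<close>, which still satisfies \<open>\<psi> x * F x y \<le> h y\<close>. Its integral is at most the limit of the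
  integrals by Fatou's lemma, and a second use of that lemma, with lower semicontinuity of
  \<^const>\<open>excess\<close>, handles the other term.\<close>

lemma dual_optimizer_compact:
  assumes g: "\<And>v u. 0 < v \<Longrightarrow> v \<le> u \<Longrightarrow> G v - g * v \<le> G u - g * u"
  obtains f where "dual_optimizer (conical_cost G F) \<mu> \<nu> f"
    "\<And>y. f y \<le> max 0 (- g) * hi / lo * hi" "antimono_on {0..} G \<Longrightarrow> \<forall>y. 0 \<le> f y"
proof -
  interpret \<mu>: prob_space \<mu> by (rule prob_\<mu>)
  interpret \<nu>: prob_space \<nu> by (rule prob_\<nu>)
  obtain I where I: "transport_cost (conical_cost G F) \<mu> \<nu> = ereal I" using transport_cost_finite by blast
  define C where "C = max 0 (- g) * hi"
  define B where "B = max \<bar>I - max (G 0) (G (2 * hi))\<bar> C"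
  define \<epsilon> where "\<epsilon> n = B / lo * inverse (real (Suc n))" for n
  define U where "U = C / lo * hi + B / lo"
  have B0: "0 \<le> B" by (simp add: B_def)
  have \<epsilon>0: "\<epsilon> \<longlonglongrightarrow> 0"
    unfolding \<epsilon>_def using tendsto_mult[OF tendsto_const LIMSEQ_inverse_real_of_nat, of "B / lo"] by simp
  have \<epsilon>1: "\<epsilon> n \<le> B / lo" for n
    unfolding \<epsilon>_def using B0 lo_pos by (intro mult_left_le) (auto simp: field_simps)
  have "\<forall>n. \<exists>f \<phi>. f \<in> borel_measurable borel \<and> \<phi> \<in> borel_measurable borel \<and>
    (\<forall>y. - B \<le> f y \<and> f y \<le> C / lo * hi + \<epsilon> n) \<and> (antimono_on {0..} G \<longrightarrow> (\<forall>y. 0 \<le> f y)) \<and>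
    (\<forall>x. \<bar>\<phi> x\<bar> \<le> B / lo) \<and>
    (\<forall>x x' d. (\<forall>y. \<bar>F x y - F x' y\<bar> \<le> d) \<longrightarrow> \<phi> x' \<le> \<phi> x + B * d / lo\<^sup>2) \<and>
    (\<forall>x y. \<phi> x * F x y \<le> f y) \<and>
    enn2ereal (\<integral>\<^sup>+x. excess G (\<phi> x) \<partial>\<mu>) \<le> ereal (G 0 - I - (\<integral>y. f y \<partial>\<nu>) + \<epsilon> n)"
    unfolding \<epsilon>_def B_def C_def by (intro allI near_optimal_pair[OF I g]) auto
  then obtain f \<phi> where
    fm[measurable]: "\<And>n. f n \<in> borel_measurable borel" and \<phi>m[measurable]: "\<And>n. \<phi> n \<in> borel_measurable borel"
    and fB: "\<And>n y. - B \<le> f n y" "\<And>n y. f n y \<le> C / lo * hi + \<epsilon> n"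
    and fpos: "\<And>n y. antimono_on {0..} G \<Longrightarrow> 0 \<le> f n y"
    and \<phi>B: "\<And>n x. \<bar>\<phi> n x\<bar> \<le> B / lo"
    and \<phi>eq: "\<And>n x x' d. (\<forall>y. \<bar>F x y - F x' y\<bar> \<le> d) \<Longrightarrow> \<phi> n x' \<le> \<phi> n x + B * d / lo\<^sup>2"
    and feas: "\<And>n x y. \<phi> n x * F x y \<le> f n y"
    and val: "\<And>n. enn2ereal (\<integral>\<^sup>+x. excess G (\<phi> n x) \<partial>\<mu>) \<le> ereal (G 0 - I - (\<integral>y. f n y \<partial>\<nu>) + \<epsilon> n)"
    by metis
  have fU: "f n y \<le> U" for n y using fB(2)[of n y] \<epsilon>1[of n] by (simp add: U_def)
  have f_abs: "\<bar>f n y\<bar> \<le> max B \<bar>U\<bar>" for n y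
    using fB(1)[of n y] fU[of n y] by linarith
  have intf: "integrable \<nu> (f n)" for n
    by (rule \<nu>.integrable_const_bound[where B="max B \<bar>U\<bar>"]) (use f_abs in auto)
  define M where "M = max (B / lo) (max B \<bar>U\<bar>)"
  have "\<bar>\<integral>y. f n y \<partial>\<nu>\<bar> \<le> M" for n
  proof -
    have "- B \<le> (\<integral>y. f n y \<partial>\<nu>)" "(\<integral>y. f n y \<partial>\<nu>) \<le> U"
      using \<nu>.integral_ge_const[OF intf, of "- B" n] \<nu>.integral_le_const[OF intf, of n U] fB(1) fU by auto
    then show ?thesis by (auto simp: M_def abs_le_iff)
  qed
  moreover have "\<bar>\<phi> n x\<bar> \<le> M" for n x using \<phi>B[of n x] by (simp add: M_def)
  note bounds = this calculation
  obtain k \<psi> b where k: "strict_mono (k :: nat \<Rightarrow> nat)"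
    and \<psi>: "\<And>x. (\<lambda>n. \<phi> (k n) x) \<longlonglongrightarrow> \<psi> x" and b: "(\<lambda>n. \<integral>y. f (k n) y \<partial>\<nu>) \<longlonglongrightarrow> b"
  proof (rule equicontinuous_subsequence[of \<phi> M "\<lambda>n. \<integral>y. f n y \<partial>\<nu>" "B / lo\<^sup>2"])
    show "\<phi> n x' \<le> \<phi> n x + B / lo\<^sup>2 * d" if "\<forall>y. \<bar>F x y - F x' y\<bar> \<le> d" for n x x' d
      using \<phi>eq[OF that, of n] by simp
  qed (use B0 bounds in auto)
  have \<epsilon>k: "(\<lambda>n. \<epsilon> (k n)) \<longlonglongrightarrow> 0" using LIMSEQ_subseq_LIMSEQ[OF \<epsilon>0 k] by (simp add: comp_def)
  define h where "h y = real_liminf B (\<lambda>n. f (k n) y)" for y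
  have fk: "\<And>n. - B \<le> f (k n) y" "\<And>n. f (k n) y \<le> U" for y using fB(1) fU by auto
  have [measurable]: "h \<in> borel_measurable borel" unfolding h_def[abs_def] real_liminf_def by measurable
  have h_up: "h y \<le> C / lo * hi" for y
  proof -
    have "(\<lambda>n. C / lo * hi + \<epsilon> (k n)) \<longlonglongrightarrow> C / lo * hi + 0" by (intro tendsto_intros \<epsilon>k)
    then show ?thesis
      unfolding h_def using fB(2) by (intro real_liminf_le[where a="\<lambda>n. f (k n) y", OF fk]) auto
  qed
  have h_lo: "- B \<le> h y" for y
    unfolding h_def by (rule ennreal_real_liminf(2)[where a="\<lambda>n. f (k n) y", OF fk])
  have h_nonneg: "0 \<le> h y" if "antimono_on {0..} G" for y
    unfolding h_def using fpos[OF that]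
    by (intro real_liminf_ge[where a="\<lambda>n. f (k n) y" and b="\<lambda>_. 0", OF fk]) auto
  have h_feas: "\<psi> x * F x y \<le> h y" for x y
    unfolding h_def using feas \<psi>
    by (intro real_liminf_ge[where a="\<lambda>n. f (k n) y" and b="\<lambda>n. \<phi> (k n) x * F x y", OF fk] tendsto_intros) auto
  have h_abs: "\<bar>h y\<bar> \<le> max B (C / lo * hi)" for y
    using h_lo[of y] h_up[of y] by linarith
  have h_bdd: "bounded (range h)"
    unfolding bounded_iff using h_abs by auto
  have inth: "integrable \<nu> h"
    by (rule \<nu>.integrable_const_bound[where B="max B (C / lo * hi)"]) (use h_abs in auto)
  have "(\<integral>y. h y \<partial>\<nu>) \<le> b"
  proof -
    have "ennreal ((\<integral>y. h y \<partial>\<nu>) + B) = ennreal (\<integral>y. h y + B \<partial>\<nu>)" using inth by (simp add: \<nu>.prob_space)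
    also have "\<dots> = (\<integral>\<^sup>+y. ennreal (h y + B) \<partial>\<nu>)"
    proof (intro nn_integral_eq_integral[symmetric] always_eventually allI)
      show "0 \<le> h y + B" for y using h_lo[of y] by linarith
    qed (use inth in auto)
    also have "\<dots> = (\<integral>\<^sup>+y. liminf (\<lambda>n. ennreal (f (k n) y + B)) \<partial>\<nu>)"
      unfolding h_def using ennreal_real_liminf(1)[where a="\<lambda>n. f (k n) y" for y, OF fk] by simp
    also have "\<dots> \<le> liminf (\<lambda>n. \<integral>\<^sup>+y. ennreal (f (k n) y + B) \<partial>\<nu>)"
      by (rule nn_integral_liminf) measurable
    also have "(\<lambda>n. \<integral>\<^sup>+y. ennreal (f (k n) y + B) \<partial>\<nu>) = (\<lambda>n. ennreal ((\<integral>y. f (k n) y \<partial>\<nu>) + B))"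
    proof
      fix n
      have "(\<integral>\<^sup>+y. ennreal (f (k n) y + B) \<partial>\<nu>) = ennreal (\<integral>y. f (k n) y + B \<partial>\<nu>)"
      proof (intro nn_integral_eq_integral always_eventually allI)
        show "0 \<le> f (k n) y + B" for y using fB(1)[of "k n" y] by linarith
      qed (use intf in auto)
      then show "(\<integral>\<^sup>+y. ennreal (f (k n) y + B) \<partial>\<nu>) = ennreal ((\<integral>y. f (k n) y \<partial>\<nu>) + B)"
        using intf by (simp add: \<nu>.prob_space)
    qed
    also have "liminf \<dots> = ennreal (b + B)"
      using b by (intro lim_imp_Liminf tendsto_intros) auto
    finally have "ennreal ((\<integral>y. h y \<partial>\<nu>) + B) \<le> ennreal (b + B)" .
    moreover have "- B \<le> (\<integral>y. h y \<partial>\<nu>)" using \<nu>.integral_ge_const[OF inth, of "- B"] h_lo by auto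
    moreover have "- B \<le> b"
      using \<nu>.integral_ge_const[OF intf, of "- B"] fB(1) by (intro LIMSEQ_le_const[OF b]) auto
    ultimately show ?thesis by (simp add: ennreal_le_iff)
  qed
  moreover have "enn2ereal (\<integral>\<^sup>+x. excess G (\<psi> x) \<partial>\<mu>) \<le> ereal (G 0 - I - b)"
  proof -
    define d where "d n = G 0 - I - (\<integral>y. f (k n) y \<partial>\<nu>) + \<epsilon> (k n)" for n
    have d: "0 \<le> d n" "(\<integral>\<^sup>+x. excess G (\<phi> (k n) x) \<partial>\<mu>) \<le> ennreal (d n)" for n
    proof -
      have le: "enn2ereal (\<integral>\<^sup>+x. excess G (\<phi> (k n) x) \<partial>\<mu>) \<le> ereal (d n)" unfolding d_def by (rule val)
      have "0 \<le> ereal (d n)" using enn2ereal_nonneg le by (rule order_trans)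
      then show "0 \<le> d n" by simp
      with le show "(\<integral>\<^sup>+x. excess G (\<phi> (k n) x) \<partial>\<mu>) \<le> ennreal (d n)"
        by (simp add: less_eq_ennreal.rep_eq enn2ereal_ennreal)
    qed
    have "d \<longlonglongrightarrow> G 0 - I - b + 0" unfolding d_def by (intro tendsto_intros b \<epsilon>k)
    then have dlim: "d \<longlonglongrightarrow> G 0 - I - b" by simp
    have "(\<integral>\<^sup>+x. excess G (\<psi> x) \<partial>\<mu>) \<le> (\<integral>\<^sup>+x. liminf (\<lambda>n. excess G (\<phi> (k n) x)) \<partial>\<mu>)"
      by (intro nn_integral_mono excess_liminf \<psi>)
    also have "\<dots> \<le> liminf (\<lambda>n. \<integral>\<^sup>+x. excess G (\<phi> (k n) x) \<partial>\<mu>)"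
      by (rule nn_integral_liminf) measurable
    also have "\<dots> \<le> liminf (\<lambda>n. ennreal (d n))"
      using d(2) by (intro Liminf_mono always_eventually allI)
    also have "\<dots> = ennreal (G 0 - I - b)"
      using dlim by (intro lim_imp_Liminf tendsto_intros) auto
    finally have "(\<integral>\<^sup>+x. excess G (\<psi> x) \<partial>\<mu>) \<le> ennreal (G 0 - I - b)" .
    moreover have "0 \<le> G 0 - I - b" using d(1) by (intro LIMSEQ_le_const[OF dlim]) auto
    ultimately show ?thesis by (simp add: less_eq_ennreal.rep_eq enn2ereal_ennreal)
  qed
  ultimately have "enn2ereal (\<integral>\<^sup>+x. excess G (\<psi> x) \<partial>\<mu>) \<le> ereal (G 0 - I - (\<integral>y. h y \<partial>\<nu>))"
    by (elim order_trans) simp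
  then have "dual_optimizer (conical_cost G F) \<mu> \<nu> h"
    using h_feas by (intro dual_optimizerI[OF _ h_bdd _ _ I, of \<psi>]) auto
  then show thesis using h_up h_nonneg by (intro that[of h]) (auto simp: C_def)
qed

text \<open>The cells are the atoms of \<open>\<nu>\<close>. The discretisation is then exact, and there are finitely many
  multipliers, which are therefore bounded.\<close>

lemma dual_optimizer_finite:
  assumes fin: "finite (UNIV :: 'y set)"
  obtains f where "dual_optimizer (conical_cost G F) \<mu> \<nu> f" "antimono_on {0..} G \<Longrightarrow> \<forall>y. 0 \<le> f y"
proof -
  obtain I where I: "transport_cost (conical_cost G F) \<mu> \<nu> = ereal I" using transport_cost_finite by blast
  have "cell_partition F G \<mu> \<nu> lo hi {y\<in>UNIV. 0 < measure \<nu> {y}} (\<lambda>y. {y})"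
    by (rule cell_partition_positive[OF fin]) (auto simp: disjoint_family_on_def)
  then interpret cell_partition F G \<mu> \<nu> lo hi "{y\<in>UNIV. 0 < measure \<nu> {y}}" "\<lambda>y. {y}" .
  let ?J = "{y\<in>UNIV. 0 < measure \<nu> {y}}"
  obtain l where l: "\<forall>q\<in>cell_controls. I + (\<Sum>i\<in>?J. l i * w i) \<le> cell_cost q + (\<Sum>i\<in>?J. l i * (\<integral>x. q i x \<partial>\<mu>))"
    using cell_multipliers[OF I] by blast
  define B where "B = Max (insert 0 ((\<lambda>y. \<bar>l y\<bar>) ` ?J))"
  have B: "\<bar>l y\<bar> \<le> B" if "y \<in> ?J" for y
    unfolding B_def using that fin_J by (intro Max_ge) auto
  have B0: "0 \<le> B" unfolding B_def using fin_J by (intro Max_ge) auto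
  define f where "f = cell_lift l (B / lo * hi)"
  have 1: "f \<in> borel_measurable borel" unfolding f_def by (rule cell_lift_measurable)
  have 2: "bounded (range f)" using fin by (intro finite_imp_bounded) (auto intro: finite_subset)
  have "cell_slope l x * F x y \<le> cell_lift (\<lambda>i. l i + B / lo * 0) (B / lo * hi) y" for x y
    using B B0 by (intro cell_slope_lift) (auto simp: abs_le_iff)
  then have 3: "cell_slope l x * F x y \<le> f y" for x y by (simp add: f_def)
  have 4: "enn2ereal (\<integral>\<^sup>+x. excess G (cell_slope l x) \<partial>\<mu>) \<le> ereal (G 0 - I - (\<integral>y. f y \<partial>\<nu>))"
    unfolding f_def integral_cell_lift by (rule cell_dual_bound[OF l])
  have "0 \<le> f y" if "antimono_on {0..} G" for y
    unfolding f_def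
  proof (cases rule: cell_lift_cases[of y l "B / lo * hi"])
    case (1 i)
    then show "0 \<le> cell_lift l (B / lo * hi) y" using multipliers_nonneg[OF l 1(1) that] by simp
  next
    case 2
    then show "0 \<le> cell_lift l (B / lo * hi) y" using B0 lo_pos hi_pos by simp
  qed
  with dual_optimizerI[OF 1 2 3 4 I] show thesis by (intro that[of f]) auto
qed

text \<open>The derivative of a convex function is non-decreasing, so its limit at \<open>0\<close> is its infimum,
  and any real number below the limit serves.\<close>

lemma slope_minorant:
  assumes "deriv_at_zero G > - \<infinity>"
  obtains g where "\<And>v u. 0 < v \<Longrightarrow> v \<le> u \<Longrightarrow> G v - g * v \<le> G u - g * u"
proof -
  have D: "(G has_real_derivative deriv G v) (at v)" if "0 < v" for v
    using G_diff[OF that] DERIV_deriv_iff_real_differentiable by blast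
  have tangent: "deriv G v * (u - v) \<le> G u - G v" if "0 < v" "0 < u" for u v
    using that by (intro convex_on_imp_above_tangent[OF G_convex _ _ _ has_field_derivative_at_within[OF D]])
      (auto simp: interior_real_atLeast)
  have mono: "deriv G v \<le> deriv G u" if "0 < v" "v \<le> u" for u v
  proof (cases "v = u")
    case False
    have "deriv G v * (u - v) \<le> deriv G u * (u - v)"
      using tangent[of v u] tangent[of u v] that by (simp add: algebra_simps)
    then show ?thesis using that False by simp
  qed simp
  define L where "L = (INF u\<in>{0<..}. ereal (deriv G u))"
  have L_le: "L \<le> ereal (deriv G u)" if "0 < u" for u
    unfolding L_def using that by (intro INF_lower) simp
  have "((\<lambda>u. ereal (deriv G u)) \<longlongrightarrow> L) (at_right 0)"
  proof (rule order_tendstoI)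
    fix a assume "a < L"
    then have "a < ereal (deriv G u)" if "0 < u" for u
      using L_le[OF that] by (rule less_le_trans)
    then show "eventually (\<lambda>u. a < ereal (deriv G u)) (at_right 0)"
      by (intro eventually_at_rightI[of 0 1]) auto
  next
    fix a assume "L < a"
    then obtain u where u: "0 < u" "ereal (deriv G u) < a" by (auto simp: L_def INF_less_iff)
    have "ereal (deriv G v) < a" if "0 < v" "v < u" for v
    proof (rule le_less_trans[OF _ u(2)])
      show "ereal (deriv G v) \<le> ereal (deriv G u)" using mono[of v u] that by simp
    qed
    then show "eventually (\<lambda>v. ereal (deriv G v) < a) (at_right 0)"
      using u by (intro eventually_at_rightI[of 0 u]) auto
  qed
  then have "deriv_at_zero G = L"
    unfolding deriv_at_zero_def by (intro tendsto_Lim) auto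
  then obtain g where g: "ereal g < L" using ereal_dense2[of "- \<infinity>" L] assms by auto
  have g_le: "g \<le> deriv G v" if "0 < v" for v
    using less_le_trans[OF g L_le[OF that]] by simp
  have "G v - g * v \<le> G u - g * u" if "0 < v" "v \<le> u" for u v
  proof -
    have "g * (u - v) \<le> deriv G v * (u - v)"
      using g_le[OF that(1)] that by (intro mult_right_mono) auto
    then show ?thesis using tangent[of v u] that by (simp add: algebra_simps)
  qed
  then show thesis by (rule that)
qed

end

theorem theorem4p1:
  fixes F :: "'x::polish_space \<Rightarrow> 'y::polish_space \<Rightarrow> real"
    and G :: "real \<Rightarrow> real"
    and \<mu> :: "'x measure" and \<nu> :: "'y measure"
  assumes compact_X: "compact (UNIV :: 'x set)"
    and compact_Y: "compact (UNIV :: 'y set)"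
    and F_pos: "\<And>x y. F x y > 0"
    and F_cont: "continuous_on UNIV (\<lambda>(x, y). F x y)"
    and G_convex: "convex_on {0..} G"
    and G_diff: "\<And>u. u > 0 \<Longrightarrow> G differentiable (at u)"
    and cost_lsc: "lower_semicontinuous_map (prod_topology euclidean weak_topology)
                     (\<lambda>(x, m). conical_cost G F x m)"
    and slope: "deriv_at_zero G > -\<infinity> \<or> (deriv_at_zero G = -\<infinity> \<and> finite (UNIV :: 'y set))"
    and \<mu>: "\<mu> \<in> borel_prob_measures"
    and \<nu>: "\<nu> \<in> borel_prob_measures"
  shows "(\<exists>f. dual_optimizer (conical_cost G F) \<mu> \<nu> f) \<and>
         (mono_on {0..} G \<longrightarrow>
            (\<exists>f. dual_optimizer (conical_cost G F) \<mu> \<nu> f \<and> (\<forall>y. f y \<le> 0))) \<and>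
         (antimono_on {0..} G \<longrightarrow>
            (\<exists>f. dual_optimizer (conical_cost G F) \<mu> \<nu> f \<and> (\<forall>y. f y \<ge> 0)))"
proof -
  have comp: "compact (UNIV :: ('x \<times> 'y) set)"
    using compact_Times[OF compact_X compact_Y] by simp
  obtain p where p: "\<And>q. (\<lambda>(x, y). F x y) p \<le> (\<lambda>(x, y). F x y) q"
    using continuous_attains_inf[OF comp _ F_cont] by auto
  obtain r where r: "\<And>q. (\<lambda>(x, y). F x y) q \<le> (\<lambda>(x, y). F x y) r"
    using continuous_attains_sup[OF comp _ F_cont] by auto
  define lo where "lo = F (fst p) (snd p)"
  define hi where "hi = F (fst r) (snd r)"
  interpret conical_transport F G \<mu> \<nu> lo hi
  proof
    show "0 < lo" unfolding lo_def by (rule F_pos)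
    show "lo \<le> F x y" for x y using p[of "(x, y)"] by (simp add: lo_def case_prod_beta)
    show "F x y \<le> hi" for x y using r[of "(x, y)"] by (simp add: hi_def case_prod_beta)
  qed (fact assms)+
  have "\<exists>f. dual_optimizer (conical_cost G F) \<mu> \<nu> f \<and> (mono_on {0..} G \<longrightarrow> (\<forall>y. f y \<le> 0)) \<and>
      (antimono_on {0..} G \<longrightarrow> (\<forall>y. 0 \<le> f y))"
  proof (cases "mono_on {0..} G")
    case True
    then have "G v - 0 * v \<le> G u - 0 * u" if "0 < v" "v \<le> u" for u v
      using that by (auto simp: monotone_on_def)
    from dual_optimizer_compact[OF this] obtain f where "dual_optimizer (conical_cost G F) \<mu> \<nu> f"
      "\<And>y. f y \<le> max 0 (- 0) * hi / lo * hi" "antimono_on {0..} G \<Longrightarrow> \<forall>y. 0 \<le> f y"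
      by blast
    then show ?thesis by (intro exI[of _ f]) simp
  next
    case False
    show ?thesis
    proof (cases "deriv_at_zero G > - \<infinity>")
      case True
      then obtain g where "\<And>v u. 0 < v \<Longrightarrow> v \<le> u \<Longrightarrow> G v - g * v \<le> G u - g * u"
        using slope_minorant by blast
      from dual_optimizer_compact[OF this] obtain f where "dual_optimizer (conical_cost G F) \<mu> \<nu> f"
        "antimono_on {0..} G \<Longrightarrow> \<forall>y. 0 \<le> f y" by blast
      then show ?thesis using False by blast
    next
      case False
      with slope have "finite (UNIV :: 'y set)" by blast
      from dual_optimizer_finite[OF this] obtain f where "dual_optimizer (conical_cost G F) \<mu> \<nu> f"
        "antimono_on {0..} G \<Longrightarrow> \<forall>y. 0 \<le> f y" by blast
      then show ?thesis using \<open>\<not> mono_on {0..} G\<close> by blast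
    qed
  qed
  then show ?thesis by blast
qed

end
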